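(* Let $n\ge1$, let $g:[0,1]\to\mathbb{R}$ be continuous with $g(0)=0$, and let $\mu$ be a Borel measure on the closed unit ball $\overline{\mathbb{B}^n}$ satisfying $0<\mu(\overline{\mathbb{B}^n})<\infty$ and the point mass condition $$\mu(\{y\})<\tfrac12\,\mu(\overline{\mathbb{B}^n})\qquad\text{for all } y\in\partial\mathbb{B}^n.$$ Let $V(x)=\int_{\overline{\mathbb{B}^n}}v(T_x(y))\,d\mu(y)$ for $x\in\mathbb{B}^n$, with $v$ and $T_x$ as in the context. (a) [Existence] If $g(1)>0$ then $V(x_c)=0$ for some $x_c\in\mathbb{B}^n$. (b) [Uniqueness] If either (i) $g$ is strictly increasing, or (ii) $g$ is increasing, $g(r)>0$ whenever $0<r<1$, and $\mu$ is not supported in the closure of a hyperbolic geodesic, then the point $x_c\in\mathbb{B}^n$ with $V(x_c)=0$ is unique (i.e. $V$ has exactly one zero in $\mathbb{B}^n$; denote it $x_c(\mu)$). (c) [Continuous dependence] Suppose $\mu_k\to\mu$ weakly as $k\to\infty$, where the $\mu_k$ are Borel measures on $\overline{\mathbb{B}^n}$ satisfying $0<\mu_k(\overline{\mathbb{B}^n})<\infty$ and $\mu_k(\{y\})<\frac12\mu_k(\overline{\mathbb{B}^n})$ for all $y\in\partial\mathbb{B}^n$, for all $k$. If either (i) holds, or else (ii) holds for $\mu$ and for each $\mu_k$ (that is, (ii) holds as stated and also with $\mu$ replaced by $\mu_k$ for every $k$), then $x_c(\mu_k)\to x_c(\mu)$ as $k\to\infty$.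
   Context: $\mathbb{B}^n$ is the open unit ball centered at the origin in $\mathbb{R}^n$, $\overline{\mathbb{B}^n}$ its closure, $\partial\mathbb{B}^n$ the unit sphere, and $|\cdot|$ is the euclidean norm. For $x\in\mathbb{B}^n$ the M\"obius transformation $T_x:\overline{\mathbb{B}^n}\to\overline{\mathbb{B}^n}$ is $$T_x(y)=\frac{(1+2x\cdot y+|y|^2)x+(1-|x|^2)y}{1+2x\cdot y+|x|^2|y|^2},\qquad y\in\overline{\mathbb{B}^n}.$$ The radial vector field $v:\overline{\mathbb{B}^n}\to\mathbb{R}^n$ is $v(y)=g(|y|)\,y/|y|$ for $y\neq0$ and $v(0)=0$. "Increasing" means non-strictly increasing (nondecreasing). Hyperbolic geodesics in $\mathbb{B}^n$ are the (complete) curves that are either straight-line diameters through the origin, or arcs in $\mathbb{B}^n$ of circles meeting the unit sphere at right angles (when $n=1$ the only geodesic is $(-1,1)$). The closure of a geodesic is its euclidean closure, consisting of the geodesic together with its endpoints on the unit sphere. "$\mu$ is not supported in the closure of a hyperbolic geodesic" means $\mu(\overline{\mathbb{B}^n}\setminus\overline{\gamma})>0$ for every hyperbolic geodesic $\gamma$. Weak convergence $\mu_k\to\mu$ means $\int\psi\,d\mu_k\to\int\psi\,d\mu$ for every continuous real function $\psi$ on $\overline{\mathbb{B}^n}$. *)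

theory Defs
  imports "HOL-Analysis.Analysis"
begin

text \<open>For points \<open>x\<close> of the open unit ball and \<open>y\<close> of the closed unit ball the denominator is
  positive.\<close>

definition moebius_ball :: "real^'n \<Rightarrow> real^'n \<Rightarrow> real^'n" where
  "moebius_ball x y =
     ((1 + 2 * (x \<bullet> y) + (norm y)\<^sup>2) *\<^sub>R x + (1 - (norm x)\<^sup>2) *\<^sub>R y)
       /\<^sub>R (1 + 2 * (x \<bullet> y) + (norm x)\<^sup>2 * (norm y)\<^sup>2)"

definition radial_field :: "(real \<Rightarrow> real) \<Rightarrow> real^'n \<Rightarrow> real^'n" where
  "radial_field g y = (if y = 0 then 0 else g (norm y) *\<^sub>R (y /\<^sub>R norm y))"

definition moebius_average :: "(real \<Rightarrow> real) \<Rightarrow> (real^'n) measure \<Rightarrow> real^'n \<Rightarrow> real^'n" where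
  "moebius_average g M x = (\<integral>y. radial_field g (moebius_ball x y) \<partial>M)"

text \<open>The first conjunct also forces \<open>space M = cball 0 1\<close>.\<close>

definition finite_borel_measure_cball :: "(real^'n) measure \<Rightarrow> bool" where
  "finite_borel_measure_cball M \<longleftrightarrow>
     sets M = sets (restrict_space borel (cball 0 1)) \<and>
     0 < emeasure M (cball 0 1) \<and> emeasure M (cball 0 1) < \<infinity>"

definition point_mass_condition :: "(real^'n) measure \<Rightarrow> bool" where
  "point_mass_condition M \<longleftrightarrow>
     (\<forall>y \<in> sphere 0 1. measure M {y} < 1/2 * measure M (cball 0 1))"

text \<open>The circle with centre \<open>c\<close> and radius \<open>r\<close> in the plane through \<open>c\<close> spanned by an
  orthonormal pair \<open>a\<close>, \<open>b\<close>, traversed by the angle \<open>t\<close>; \<open>circle_tangent\<close> is the unit tangent at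
  angle \<open>t\<close>.\<close>

definition circle_point :: "real^'n \<Rightarrow> real \<Rightarrow> real^'n \<Rightarrow> real^'n \<Rightarrow> real \<Rightarrow> real^'n" where
  "circle_point c r a b t = c + r *\<^sub>R (cos t *\<^sub>R a + sin t *\<^sub>R b)"

definition circle_tangent :: "real^'n \<Rightarrow> real^'n \<Rightarrow> real \<Rightarrow> real^'n" where
  "circle_tangent a b t = - sin t *\<^sub>R a + cos t *\<^sub>R b"

text \<open>At each common point \<open>p\<close> the tangent of the circle is orthogonal to the whole tangent space
  of the unit sphere, which consists of the \<open>w\<close> with \<open>w \<bullet> p = 0\<close>.\<close>

definition meets_sphere_at_right_angles ::
    "real^'n \<Rightarrow> real \<Rightarrow> real^'n \<Rightarrow> real^'n \<Rightarrow> bool" where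
  "meets_sphere_at_right_angles c r a b \<longleftrightarrow>
     (\<exists>t. circle_point c r a b t \<in> sphere 0 1) \<and>
     (\<forall>t. circle_point c r a b t \<in> sphere 0 1 \<longrightarrow>
        (\<forall>w. w \<bullet> circle_point c r a b t = 0 \<longrightarrow> w \<bullet> circle_tangent a b t = 0))"

text \<open>A circle orthogonal to the unit sphere meets the open ball in a single arc. In dimension one
  there is no orthonormal pair, so the second alternative is void.\<close>

definition hyperbolic_geodesic :: "(real^'n) set \<Rightarrow> bool" where
  "hyperbolic_geodesic \<gamma> \<longleftrightarrow>
     (\<exists>u. norm u = 1 \<and> \<gamma> = {t *\<^sub>R u | t. -1 < t \<and> t < 1}) \<or>
     (\<exists>c r a b. 0 < r \<and> norm a = 1 \<and> norm b = 1 \<and> a \<bullet> b = 0 \<and>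
        meets_sphere_at_right_angles c r a b \<and>
        \<gamma> = range (circle_point c r a b) \<inter> ball 0 1)"

definition supported_in_closed_geodesic :: "(real^'n) measure \<Rightarrow> bool" where
  "supported_in_closed_geodesic M \<longleftrightarrow>
     (\<exists>\<gamma>. hyperbolic_geodesic \<gamma> \<and> \<not> 0 < emeasure M (cball 0 1 - closure \<gamma>))"

definition condition_i :: "(real \<Rightarrow> real) \<Rightarrow> bool" where
  "condition_i g \<longleftrightarrow> strict_mono_on {0..1} g"

definition condition_ii :: "(real \<Rightarrow> real) \<Rightarrow> (real^'n) measure \<Rightarrow> bool" where
  "condition_ii g M \<longleftrightarrow>
     mono_on {0..1} g \<and> (\<forall>r. 0 < r \<and> r < 1 \<longrightarrow> 0 < g r) \<and> \<not> supported_in_closed_geodesic M"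

definition weakly_converges_cball :: "(nat \<Rightarrow> (real^'n) measure) \<Rightarrow> (real^'n) measure \<Rightarrow> bool" where
  "weakly_converges_cball Mk M \<longleftrightarrow>
     (\<forall>\<psi> :: real^'n \<Rightarrow> real. continuous_on (cball 0 1) \<psi> \<longrightarrow>
        (\<lambda>k. \<integral>y. \<psi> y \<partial>Mk k) \<longlonglongrightarrow> (\<integral>y. \<psi> y \<partial>M))"

text \<open>Meaningful only where the zero in the open ball exists and is unique.\<close>

definition conformal_centre :: "(real \<Rightarrow> real) \<Rightarrow> (real^'n) measure \<Rightarrow> real^'n" where
  "conformal_centre g M = (THE x. x \<in> ball 0 1 \<and> moebius_average g M x = 0)"

end

theory Submission
  imports Defs
begin

text \<open>Existence: as \<open>x\<close> approaches a boundary point \<open>\<xi>\<close>, \<open>T\<^sub>x(y) \<rightarrow> \<xi>\<close> for all \<open>y \<noteq> -\<xi>\<close>, so by the point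
  mass condition \<open>V\<close> points outward near the sphere, and Brouwer's theorem yields a zero.

  Uniqueness: if \<open>x\<^sub>1 \<noteq> x\<^sub>2\<close> are zeros, then up to an orthogonal map \<open>T\<close> at \<open>x\<^sub>2\<close> is \<open>T\<close> at \<open>x\<^sub>1\<close> followed by
  a hyperbolic translation along an axis \<open>u\<close>. Such a translation increases \<open>v(z) \<bullet> u\<close> at every \<open>z\<close>, strictly
  off the axis (and on the open axis if \<open>g\<close> is strictly increasing). As both integrals vanish, \<open>\<mu>\<close> lives where
  there is no strict increase: on a closed geodesic, or on its two endpoints, which the point mass
  condition excludes.

  Continuous dependence: a limit point of \<open>x\<^sub>c(\<mu>\<^sub>k)\<close> in the open ball is a zero of \<open>V\<close> because \<open>V\<close> depends
  jointly continuously on \<open>x\<close> and the measure; a limit point on the sphere is excluded by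
  comparing \<open>v(T\<^sub>x(y)) \<bullet> \<xi>\<close> with a constant minus a continuous cutoff at \<open>-\<xi>\<close>.\<close>

section \<open>Moebius transformations of the ball\<close>

text \<open>The denominator of \<open>moebius_ball\<close>, with squared norms written as inner
  products so that the identities below become polynomial ones.\<close>

definition moebius_denom :: "real^'n \<Rightarrow> real^'n \<Rightarrow> real" where
  "moebius_denom x y = 1 + 2 * (x \<bullet> y) + (x \<bullet> x) * (y \<bullet> y)"

text \<open>In this form both summands are visibly nonnegative on the closed balls.\<close>

lemma moebius_denom_eq:
  "moebius_denom x y = (x + y) \<bullet> (x + y) + (1 - x \<bullet> x) * (1 - y \<bullet> y)"
  by (simp add: moebius_denom_def algebra_simps inner_add_left inner_add_right inner_commute)

lemma in_ball_iff_inner: "x \<in> ball 0 1 \<longleftrightarrow> x \<bullet> x < (1::real)" for x :: "real^'n"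
  by (simp add: dist_norm norm_eq_sqrt_inner)

lemma in_cball_iff_inner: "x \<in> cball 0 1 \<longleftrightarrow> x \<bullet> x \<le> (1::real)" for x :: "real^'n"
  by (simp add: dist_norm norm_eq_sqrt_inner)

lemma in_sphere_iff_inner: "x \<in> sphere 0 1 \<longleftrightarrow> x \<bullet> x = (1::real)" for x :: "real^'n"
  by (simp add: dist_norm norm_eq_sqrt_inner)

lemma moebius_denom_ge:
  assumes "x \<in> cball 0 1" "y \<in> cball 0 1"
  shows "(norm (x + y))\<^sup>2 \<le> moebius_denom x y"
  using assms unfolding in_cball_iff_inner
  by (simp add: moebius_denom_eq power2_norm_eq_inner)

text \<open>If |y| < 1 the second summand of \<open>moebius_denom_eq\<close> is positive; if |y| = 1
  it vanishes, but |x| < |y| forces x + y to be nonzero.\<close>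

lemma moebius_denom_pos:
  assumes "x \<in> ball 0 1" "y \<in> cball 0 1"
  shows "0 < moebius_denom x y"
proof (cases "y \<bullet> y < 1")
  case True
  then have "0 < (1 - x \<bullet> x) * (1 - y \<bullet> y)"
    using assms(1) True unfolding in_ball_iff_inner by simp
  then show ?thesis
    by (simp add: moebius_denom_eq add_nonneg_pos)
next
  case False
  then have "norm x < norm y"
    using assms by (simp add: dist_norm not_less norm_eq_sqrt_inner)
  then have "x + y \<noteq> 0"
    by (metis add_eq_0_iff2 less_irrefl norm_minus_cancel)
  then have "0 < (norm (x + y))\<^sup>2" by simp
  then show ?thesis
    using moebius_denom_ge[of x y] assms by (smt (verit) ball_subset_cball subsetD)
qed

text \<open>For nonzero y and y' = y / |y|^2 the term added to x is (1 - |x|^2) (x + y') / |x +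
  y'|^2. So T_x is composed of inversions, translations and a scaling, which explains its
  conformality.\<close>

lemma moebius_ball_alt:
  assumes "moebius_denom x y \<noteq> 0"
  shows "moebius_ball x y =
    x + ((1 - x \<bullet> x) / moebius_denom x y) *\<^sub>R (y + (y \<bullet> y) *\<^sub>R x)"
proof -
  have "moebius_denom x y *\<^sub>R moebius_ball x y =
      (1 + 2 * (x \<bullet> y) + y \<bullet> y) *\<^sub>R x + (1 - x \<bullet> x) *\<^sub>R y"
    using assms by (simp add: moebius_ball_def moebius_denom_def power2_norm_eq_inner)
  also have "\<dots> = moebius_denom x y *\<^sub>R x + (1 - x \<bullet> x) *\<^sub>R (y + (y \<bullet> y) *\<^sub>R x)"
    by (simp add: moebius_denom_def algebra_simps)
  also have "\<dots> = moebius_denom x y *\<^sub>R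
      (x + ((1 - x \<bullet> x) / moebius_denom x y) *\<^sub>R (y + (y \<bullet> y) *\<^sub>R x))"
    using assms by (simp add: scaleR_add_right)
  finally show ?thesis
    using assms by (simp only: scaleR_cancel_left) auto
qed

lemma inner_moebius_vector:
  "(y + (y \<bullet> y) *\<^sub>R x) \<bullet> (y + (y \<bullet> y) *\<^sub>R x) = (y \<bullet> y) * moebius_denom x y"
  by (simp add: moebius_denom_def algebra_simps inner_add_left inner_add_right inner_commute)

lemma moebius_inner_left:
  assumes "moebius_denom x y \<noteq> 0"
  shows "moebius_denom x y * (x \<bullet> moebius_ball x y) =
    moebius_denom x y * (x \<bullet> x) + (1 - x \<bullet> x) * (x \<bullet> y + (y \<bullet> y) * (x \<bullet> x))"
  using assms by (simp add: moebius_ball_alt inner_add_right field_simps)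

text \<open>Expand |x + c h|^2 and use |h|^2 = |y|^2 d. For x in the open ball the right-hand side
  has the sign of 1 - |y|^2, so ball, closed ball and sphere are each preserved.\<close>

lemma one_minus_moebius_inner:
  assumes "moebius_denom x y \<noteq> 0"
  shows "1 - moebius_ball x y \<bullet> moebius_ball x y =
    (1 - x \<bullet> x) * (1 - y \<bullet> y) / moebius_denom x y"
proof -
  define d c where "d = moebius_denom x y" and "c = (1 - x \<bullet> x) / d"
  define h where "h = y + (y \<bullet> y) *\<^sub>R x"
  have d: "d \<noteq> 0" using assms by (simp add: d_def)
  have hh: "h \<bullet> h = (y \<bullet> y) * d"
    unfolding h_def d_def by (rule inner_moebius_vector)
  have xh: "x \<bullet> h = x \<bullet> y + (y \<bullet> y) * (x \<bullet> x)"
    by (simp add: h_def inner_add_right)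
  have "moebius_ball x y \<bullet> moebius_ball x y = x \<bullet> x + 2 * c * (x \<bullet> h) + c\<^sup>2 * (h \<bullet> h)"
    using moebius_ball_alt[OF assms]
    by (simp add: d_def[symmetric] c_def[symmetric] h_def[symmetric] inner_add_left
        inner_add_right inner_commute power2_eq_square)
  then have "d * (1 - moebius_ball x y \<bullet> moebius_ball x y) =
      d * (1 - x \<bullet> x) - 2 * (d * c) * (x \<bullet> h) - (d * c)\<^sup>2 * (y \<bullet> y)"
    by (simp add: hh algebra_simps power2_eq_square)
  also have "d * c = 1 - x \<bullet> x" using d by (simp add: c_def)
  also have "d * (1 - x \<bullet> x) - 2 * (1 - x \<bullet> x) * (x \<bullet> h) - (1 - x \<bullet> x)\<^sup>2 * (y \<bullet> y) =
      d * (1 - x \<bullet> x) - (1 - x \<bullet> x) * (2 * (x \<bullet> h) + (1 - x \<bullet> x) * (y \<bullet> y))"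
    by (simp add: algebra_simps power2_eq_square)
  also have "\<dots> = (1 - x \<bullet> x) * (1 - y \<bullet> y)"
    by (simp add: xh d_def moebius_denom_def algebra_simps)
  finally show ?thesis
    using d by (simp add: d_def[symmetric] field_simps)
qed

lemma moebius_in_ball:
  assumes "x \<in> ball 0 1" "y \<in> ball 0 1"
  shows "moebius_ball x y \<in> ball 0 1"
proof -
  have d: "0 < moebius_denom x y"
    using assms by (intro moebius_denom_pos) auto
  have "0 < (1 - x \<bullet> x) * (1 - y \<bullet> y) / moebius_denom x y"
    using assms d unfolding in_ball_iff_inner by simp
  then show ?thesis
    using one_minus_moebius_inner[of x y] d unfolding in_ball_iff_inner by simp
qed

lemma moebius_in_cball:
  assumes "x \<in> ball 0 1" "y \<in> cball 0 1"
  shows "moebius_ball x y \<in> cball 0 1"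
proof -
  have d: "0 < moebius_denom x y"
    using assms by (intro moebius_denom_pos) auto
  have "0 \<le> (1 - x \<bullet> x) * (1 - y \<bullet> y) / moebius_denom x y"
    using assms d unfolding in_ball_iff_inner in_cball_iff_inner by simp
  then show ?thesis
    using one_minus_moebius_inner[of x y] d unfolding in_cball_iff_inner by simp
qed

lemma moebius_in_sphere:
  assumes "x \<in> ball 0 1" "y \<in> sphere 0 1"
  shows "moebius_ball x y \<in> sphere 0 1"
proof -
  have "0 < moebius_denom x y"
    using assms by (intro moebius_denom_pos) auto
  then show ?thesis
    using assms one_minus_moebius_inner[of x y] unfolding in_sphere_iff_inner by simp
qed

text \<open>\<open>moebius_ball x\<close> is conformal with factor (1 - |x|^2) / d at each point,
  and a distance scales by the geometric mean of the factors at its two ends.\<close>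

lemma moebius_dist:
  assumes "moebius_denom x y \<noteq> 0" "moebius_denom x z \<noteq> 0"
  shows "(dist (moebius_ball x y) (moebius_ball x z))\<^sup>2 =
    (1 - x \<bullet> x)\<^sup>2 / (moebius_denom x y * moebius_denom x z) * (dist y z)\<^sup>2"
proof -
  define d e where "d = moebius_denom x y" and "e = moebius_denom x z"
  define h j where "h = y + (y \<bullet> y) *\<^sub>R x" and "j = z + (z \<bullet> z) *\<^sub>R x"
  have de: "d \<noteq> 0" "e \<noteq> 0" using assms by (simp_all add: d_def e_def)
  have hh: "h \<bullet> h = (y \<bullet> y) * d" and jj: "j \<bullet> j = (z \<bullet> z) * e"
    unfolding h_def d_def j_def e_def by (rule inner_moebius_vector)+
  have hj: "h \<bullet> j = y \<bullet> z + (z \<bullet> z) * (x \<bullet> y) + (y \<bullet> y) * (x \<bullet> z) + (y \<bullet> y) * (z \<bullet> z) * (x \<bullet> x)"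
    by (simp add: h_def j_def inner_add_left inner_add_right inner_commute algebra_simps)
  have "moebius_ball x y - moebius_ball x z = (1 - x \<bullet> x) *\<^sub>R (h /\<^sub>R d - j /\<^sub>R e)"
    using assms
    by (simp add: moebius_ball_alt d_def e_def h_def j_def algebra_simps divide_inverse)
  then have "(dist (moebius_ball x y) (moebius_ball x z))\<^sup>2 =
      (1 - x \<bullet> x)\<^sup>2 * ((h /\<^sub>R d - j /\<^sub>R e) \<bullet> (h /\<^sub>R d - j /\<^sub>R e))"
    by (simp only: dist_norm power2_norm_eq_inner inner_scaleR_left inner_scaleR_right)
       (simp add: power2_eq_square)
  also have "(h /\<^sub>R d - j /\<^sub>R e) \<bullet> (h /\<^sub>R d - j /\<^sub>R e) =
      (h \<bullet> h) / d\<^sup>2 + (j \<bullet> j) / e\<^sup>2 - 2 * (h \<bullet> j) / (d * e)"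
    by (simp add: inner_diff_left inner_diff_right inner_commute power2_eq_square field_simps)
  also have "\<dots> = ((y \<bullet> y) * e + (z \<bullet> z) * d - 2 * (h \<bullet> j)) / (d * e)"
    unfolding hh jj using de by (simp add: power2_eq_square field_simps)
  also have "(y \<bullet> y) * e + (z \<bullet> z) * d - 2 * (h \<bullet> j) = (dist y z)\<^sup>2"
    unfolding hj d_def e_def
    by (simp add: moebius_denom_def dist_norm power2_norm_eq_inner inner_diff_left inner_diff_right
        inner_commute algebra_simps)
  finally show ?thesis by (simp add: d_def e_def)
qed

text \<open>Equivalently, the conformal factors of T_x at y and of T_(-x) at T_x(y) are
  reciprocal.\<close>

lemma moebius_denom_inverse:
  assumes "moebius_denom x y \<noteq> 0"
  shows "moebius_denom x y * moebius_denom (- x) (moebius_ball x y) = (1 - x \<bullet> x)\<^sup>2"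
proof -
  define d where "d = moebius_denom x y"
  define Y where "Y = moebius_ball x y"
  have d: "d \<noteq> 0" using assms by (simp add: d_def)
  have xY: "d * (x \<bullet> Y) = d * (x \<bullet> x) + (1 - x \<bullet> x) * (x \<bullet> y + (y \<bullet> y) * (x \<bullet> x))"
    unfolding d_def Y_def using assms by (rule moebius_inner_left)
  have YY: "d * (Y \<bullet> Y) = d - (1 - x \<bullet> x) * (1 - y \<bullet> y)"
    using one_minus_moebius_inner[OF assms] d by (simp add: d_def[symmetric] Y_def field_simps)
  have "d * moebius_denom (- x) Y = d - 2 * (d * (x \<bullet> Y)) + (x \<bullet> x) * (d * (Y \<bullet> Y))"
    by (simp add: moebius_denom_def algebra_simps)
  also have "\<dots> = (1 - x \<bullet> x)\<^sup>2"
    unfolding xY YY by (simp add: d_def moebius_denom_def algebra_simps power2_eq_square)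
  finally show ?thesis by (simp add: d_def Y_def)
qed

text \<open>Multiplied by d, the vector Y - |Y|^2 x collapses to (1 - |x|^2) (x + y). With the
  denominator from \<open>moebius_denom_inverse\<close> the alternative form of T_(-x) then reads -x
  + (x + y).\<close>

lemma moebius_inverse:
  assumes "x \<in> ball 0 1" "y \<in> cball 0 1"
  shows "moebius_ball (- x) (moebius_ball x y) = y"
proof -
  define d k where "d = moebius_denom x y" and "k = 1 - x \<bullet> x"
  define Y where "Y = moebius_ball x y"
  have k: "k \<noteq> 0" using assms(1) unfolding in_ball_iff_inner by (simp add: k_def)
  have d0: "moebius_denom x y \<noteq> 0"
    using moebius_denom_pos[OF assms] by simp
  then have d: "d \<noteq> 0" by (simp add: d_def)
  have e: "moebius_denom (- x) Y = k\<^sup>2 / d"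
    using moebius_denom_inverse[OF d0] d by (simp add: Y_def d_def[symmetric] k_def field_simps)
  have Y: "d *\<^sub>R Y = d *\<^sub>R x + k *\<^sub>R (y + (y \<bullet> y) *\<^sub>R x)"
    using d unfolding Y_def moebius_ball_alt[OF d0] d_def[symmetric] k_def[symmetric]
    by (simp add: scaleR_add_right)
  have YY: "d * (Y \<bullet> Y) = d - k * (1 - y \<bullet> y)"
    using one_minus_moebius_inner[OF d0] d by (simp add: d_def[symmetric] k_def Y_def field_simps)
  have "d *\<^sub>R (Y - (Y \<bullet> Y) *\<^sub>R x) = d *\<^sub>R Y - (d * (Y \<bullet> Y)) *\<^sub>R x"
    by (simp add: algebra_simps)
  also have "\<dots> = k *\<^sub>R (x + y)"
    unfolding Y YY by (simp add: algebra_simps)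
  finally have 1: "d *\<^sub>R (Y - (Y \<bullet> Y) *\<^sub>R x) = k *\<^sub>R (x + y)" .
  have "moebius_ball (- x) Y = - x + (k / (k\<^sup>2 / d)) *\<^sub>R (Y - (Y \<bullet> Y) *\<^sub>R x)"
    using moebius_ball_alt[of "- x" Y] d k by (simp add: e k_def)
  also have "k / (k\<^sup>2 / d) = inverse k * d"
    using k d by (simp add: field_simps power2_eq_square)
  also have "(inverse k * d) *\<^sub>R (Y - (Y \<bullet> Y) *\<^sub>R x) = inverse k *\<^sub>R k *\<^sub>R (x + y)"
    unfolding scaleR_scaleR[symmetric] 1 ..
  finally show ?thesis using k by (simp add: Y_def)
qed

lemma moebius_inverse':
  assumes "x \<in> ball 0 1" "y \<in> cball 0 1"
  shows "moebius_ball x (moebius_ball (- x) y) = y"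
  using moebius_inverse[of "- x" y] assms by simp

lemma moebius_zero_right [simp]: "moebius_ball x 0 = x"
  by (simp add: moebius_ball_def)

lemma moebius_uminus: "moebius_ball (- x) (- y) = - moebius_ball x y"
  by (simp add: moebius_ball_def algebra_simps)

lemma moebius_cancel:
  assumes "x \<in> ball 0 1"
  shows "moebius_ball x (- x) = 0" "moebius_ball (- x) x = 0"
  using moebius_inverse'[of x 0] moebius_inverse[of x 0] assms by simp_all

text \<open>Quantifies how T_x pushes everything away from -x towards x when |x| is close to 1. The
  bound comes from |h|^2 = |y|^2 d, |y| at most 1, and d at least |x + y|^2.\<close>

lemma norm_moebius_minus_le:
  assumes "x \<in> ball 0 1" "y \<in> cball 0 1" "x + y \<noteq> 0"
  shows "norm (moebius_ball x y - x) \<le> (1 - x \<bullet> x) / norm (x + y)"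
proof -
  have d: "0 < moebius_denom x y" using assms by (intro moebius_denom_pos) auto
  have k: "0 < 1 - x \<bullet> x" using assms(1) unfolding in_ball_iff_inner by simp
  have "moebius_ball x y - x = ((1 - x \<bullet> x) / moebius_denom x y) *\<^sub>R (y + (y \<bullet> y) *\<^sub>R x)"
    using d by (simp add: moebius_ball_alt)
  then have "(norm (moebius_ball x y - x))\<^sup>2 = ((1 - x \<bullet> x) / moebius_denom x y)\<^sup>2 * ((y \<bullet> y) * moebius_denom x y)"
    unfolding inner_moebius_vector[symmetric]
    by (simp only: power2_norm_eq_inner inner_scaleR_left inner_scaleR_right)
      (simp only: power2_eq_square mult.assoc)
  also have "\<dots> = (1 - x \<bullet> x)\<^sup>2 * (y \<bullet> y) / moebius_denom x y"
    using d by (simp add: power2_eq_square)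
  also have "\<dots> \<le> (1 - x \<bullet> x)\<^sup>2 * 1 / (norm (x + y))\<^sup>2"
  proof (intro frac_le mult_left_mono)
    show "y \<bullet> y \<le> 1" using assms(2) unfolding in_cball_iff_inner .
    show "(norm (x + y))\<^sup>2 \<le> moebius_denom x y"
      using assms by (intro moebius_denom_ge) auto
  qed (use assms(3) in simp_all)
  finally have "(norm (moebius_ball x y - x))\<^sup>2 \<le> ((1 - x \<bullet> x) / norm (x + y))\<^sup>2"
    by (simp only: power_divide mult_1_right)
  then show ?thesis
    using k by - (rule power2_le_imp_le, simp_all)
qed

text \<open>\<open>S\<close> is conformal with factor \<open>\<lambda>\<close>; comparing \<open>1 - |S z|\<^sup>2 = \<lambda> z (1 - |z|\<^sup>2)\<close> with
  \<open>|S z - S 0|\<^sup>2 = \<lambda> z |z|\<^sup>2\<close> forces \<open>\<lambda> = 1\<close>.\<close>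

lemma moebius_composition_inner:
  fixes x1 x2 z z' :: "real^'n"
  assumes x: "x1 \<in> ball 0 1" "x2 \<in> ball 0 1"
  defines "S \<equiv> \<lambda>z. moebius_ball x2 (moebius_ball (- x1) (moebius_ball (- moebius_ball (- x1) x2) z))"
  assumes z: "z \<in> cball 0 1" "z' \<in> cball 0 1"
  shows "S z \<bullet> S z' = z \<bullet> z'"
proof -
  define w where "w = moebius_ball (- x1) x2"
  have w: "w \<in> ball 0 1" "- w \<in> ball 0 1" "- x1 \<in> ball 0 1"
    using moebius_in_ball[of "- x1" x2] x by (auto simp: w_def)
  define P Q where "P = (\<lambda>z. moebius_ball (- w) z)" and "Q = (\<lambda>z. moebius_ball (- x1) (P z))"
  have S: "S = (\<lambda>z. moebius_ball x2 (Q z))"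
    by (simp add: S_def P_def Q_def w_def)
  \<comment> \<open>The conformal factors of the three maps in turn; their product \<open>l\<close>
    is the factor of \<open>S\<close>.\<close>
  define a b c where "a = (\<lambda>z. (1 - w \<bullet> w) / moebius_denom (- w) z)"
    and "b = (\<lambda>z. (1 - x1 \<bullet> x1) / moebius_denom (- x1) (P z))"
    and "c = (\<lambda>z. (1 - x2 \<bullet> x2) / moebius_denom x2 (Q z))"
  define l where "l = (\<lambda>z. a z * b z * c z)"
  have PQ: "P z \<in> cball 0 1" "Q z \<in> cball 0 1" if "z \<in> cball 0 1" for z
    using that w x moebius_in_cball unfolding P_def Q_def by blast+
  have dist: "(dist (S z) (S z'))\<^sup>2 = l z * l z' * (dist z z')\<^sup>2"
    and nrm: "1 - S z \<bullet> S z = l z * (1 - z \<bullet> z)"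
    if z: "z \<in> cball 0 1" "z' \<in> cball 0 1" for z z'
  proof -
    have d: "moebius_denom (- w) z \<noteq> 0" "moebius_denom (- w) z' \<noteq> 0"
       "moebius_denom (- x1) (P z) \<noteq> 0" "moebius_denom (- x1) (P z') \<noteq> 0"
       "moebius_denom x2 (Q z) \<noteq> 0" "moebius_denom x2 (Q z') \<noteq> 0"
      using moebius_denom_pos z PQ[OF z(1)] PQ[OF z(2)] w x by (metis less_irrefl)+
    have "(dist (S z) (S z'))\<^sup>2 = (c z * c z') * (dist (Q z) (Q z'))\<^sup>2"
      unfolding S moebius_dist[OF d(5,6)] c_def by (simp add: power2_eq_square)
    also have "(dist (Q z) (Q z'))\<^sup>2 = (b z * b z') * (dist (P z) (P z'))\<^sup>2"
      unfolding Q_def moebius_dist[OF d(3,4)] b_def by (simp add: power2_eq_square)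
    also have "(dist (P z) (P z'))\<^sup>2 = (a z * a z') * (dist z z')\<^sup>2"
      unfolding P_def moebius_dist[OF d(1,2)] a_def by (simp add: power2_eq_square)
    finally show "(dist (S z) (S z'))\<^sup>2 = l z * l z' * (dist z z')\<^sup>2"
      by (simp only: l_def mult_ac)
    show "1 - S z \<bullet> S z = l z * (1 - z \<bullet> z)"
      unfolding S one_minus_moebius_inner[OF d(5)] unfolding Q_def one_minus_moebius_inner[OF d(3)]
      unfolding P_def one_minus_moebius_inner[OF d(1)]
      by (simp add: l_def a_def b_def c_def P_def Q_def)
  qed
  \<comment> \<open>The three maps send 0 to -w, then to -\<open>x2\<close>, then back to 0.\<close>
  have S0: "S 0 = 0"
  proof -
    have "moebius_ball (- x1) (- w) = - moebius_ball x1 w" by (rule moebius_uminus)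
    also have "\<dots> = - x2" using moebius_inverse'[of x1 x2] x by (simp add: w_def)
    finally show ?thesis using moebius_cancel[OF x(2)] by (simp add: S Q_def P_def)
  qed
  have l0: "l 0 = 1" using nrm[of 0 0] S0 by simp
  have l1: "l z = 1" if "z \<in> cball 0 1" for z
    using dist[of z 0] nrm[of z 0] that l0 S0
    by (simp add: power2_norm_eq_inner algebra_simps)
  have "(dist (S z) (S z'))\<^sup>2 = (dist z z')\<^sup>2" "S z \<bullet> S z = z \<bullet> z" "S z' \<bullet> S z' = z' \<bullet> z'"
    using dist[OF z] nrm[OF z] nrm[OF z(2,1)] l1 z by simp_all
  then show ?thesis
    by (simp add: dist_norm power2_norm_eq_inner inner_diff_left inner_diff_right inner_commute)
qed

section \<open>Monotonicity along an axis\<close>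

text \<open>The component of v(z) in direction u. Since division by zero yields 0, the formula
  covers the origin too.\<close>

definition radial_component :: "(real \<Rightarrow> real) \<Rightarrow> real^'n \<Rightarrow> real^'n \<Rightarrow> real" where
  "radial_component g u z = g (norm z) * ((z \<bullet> u) / norm z)"

lemma radial_field_inner: "radial_field g z \<bullet> u = radial_component g u z"
  by (simp add: radial_field_def radial_component_def divide_inverse mult.commute)

lemma radial_component_uminus [simp]: "radial_component g u (- z) = - radial_component g u z"
  by (simp add: radial_component_def)

lemma moebius_axis: "\<exists>r. moebius_ball (s *\<^sub>R u) (t *\<^sub>R u) = r *\<^sub>R u"
  unfolding moebius_ball_def scaleR_scaleR scaleR_add_left[symmetric] by (rule exI) (rule refl)

context
  fixes u :: "real^'n" and s :: real
  assumes u: "norm u = 1" and s: "0 < s" "s < 1"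
begin

lemma axis_point_in_ball: "s *\<^sub>R u \<in> ball 0 1"
  using u s by (simp add: dist_norm)

text \<open>The numerator is split into (1 - s^2) (z . u) and the gain due to the translation, which
  the next lemma shows to be positive.\<close>

lemma axis_translate_inner:
  assumes "z \<in> cball 0 1"
  shows "moebius_ball (s *\<^sub>R u) z \<bullet> u =
    ((1 - s\<^sup>2) * (z \<bullet> u) + s * (1 + z \<bullet> z + 2 * s * (z \<bullet> u))) / moebius_denom (s *\<^sub>R u) z"
proof -
  have uu: "u \<bullet> u = 1" using u by (simp add: norm_eq_sqrt_inner)
  have "0 < moebius_denom (s *\<^sub>R u) z"
    using axis_point_in_ball assms by (rule moebius_denom_pos)
  then show ?thesis
    by (simp add: moebius_ball_def moebius_denom_def uu inner_add_left inner_commute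
        power2_norm_eq_inner divide_inverse power_mult_distrib)
       (simp add: algebra_simps power2_eq_square uu inner_commute)
qed

text \<open>Cauchy-Schwarz and 2 |z| <= 1 + |z|^2 bound 2 |z . u| by 1 + |z|^2, and s < 1 makes the
  inequality strict.\<close>

lemma axis_translate_numerator_pos:
  assumes "z \<in> cball 0 1"
  shows "0 < s * (1 + z \<bullet> z + 2 * s * (z \<bullet> u))"
proof -
  have "\<bar>z \<bullet> u\<bar> \<le> norm z" using Cauchy_Schwarz_ineq2[of z u] u by simp
  then have le: "2 * \<bar>z \<bullet> u\<bar> \<le> 1 + z \<bullet> z"
    using sum_squares_bound[of 1 "norm z"] by (simp add: power2_norm_eq_inner)
  have "s * (- (z \<bullet> u)) < (1 + z \<bullet> z) / 2"
  proof (cases "z \<bullet> u < 0")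
    case True
    then have "s * (- (z \<bullet> u)) < 1 * (- (z \<bullet> u))"
      using s by (intro mult_strict_right_mono) simp_all
    also have "1 * (- (z \<bullet> u)) \<le> (1 + z \<bullet> z) / 2"
      using le abs_ge_minus_self[of "z \<bullet> u"] by simp
    finally show ?thesis .
  next
    case False
    then have "s * (- (z \<bullet> u)) \<le> 0"
      using s by (simp add: mult_nonneg_nonneg)
    also have "0 < (1 + z \<bullet> z) / 2" by (simp add: add_pos_nonneg)
    finally show ?thesis .
  qed
  then have "0 < 1 + z \<bullet> z + 2 * (s * (z \<bullet> u))" by simp
  then show ?thesis using s by (simp add: mult.assoc)
qed

text \<open>1 - |Z|^2 is 1 - |z|^2 times (1 - s^2) / d. On the half space z . u >= 0 the denominator
  d is at least 1, so this factor is below 1.\<close>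

lemma axis_translate_norm:
  assumes "z \<in> cball 0 1" "0 \<le> z \<bullet> u"
  shows "norm z \<le> norm (moebius_ball (s *\<^sub>R u) z)"
    and "norm z < 1 \<Longrightarrow> norm z < norm (moebius_ball (s *\<^sub>R u) z)"
proof -
  define d where "d = moebius_denom (s *\<^sub>R u) z"
  have uu: "u \<bullet> u = 1" using u by (simp add: norm_eq_sqrt_inner)
  have "1 \<le> d"
    using assms s by (simp add: d_def moebius_denom_def inner_commute uu)
  then have d: "d > 0" and q: "(1 - s\<^sup>2) / d < 1"
    using s by (auto simp: field_simps power2_eq_square intro: add_pos_nonneg)
       (smt (verit) mult_pos_pos)
  have *: "1 - (norm (moebius_ball (s *\<^sub>R u) z))\<^sup>2 = (1 - s\<^sup>2) / d * (1 - (norm z)\<^sup>2)"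
    using one_minus_moebius_inner[of "s *\<^sub>R u" z] d unfolding power2_norm_eq_inner
    by (simp add: d_def uu power2_eq_square)
  have nz: "norm z \<le> 1" using assms by simp
  then have nz2: "(norm z)\<^sup>2 \<le> 1" by (simp add: power_le_one)
  have "(1 - s\<^sup>2) / d * (1 - (norm z)\<^sup>2) \<le> 1 - (norm z)\<^sup>2"
    using q nz2 mult_right_mono[of "(1 - s\<^sup>2) / d" 1 "1 - (norm z)\<^sup>2"] by simp
  then have "(norm z)\<^sup>2 \<le> (norm (moebius_ball (s *\<^sub>R u) z))\<^sup>2" using * by linarith
  then show "norm z \<le> norm (moebius_ball (s *\<^sub>R u) z)" by (rule power2_le_imp_le) simp
  assume "norm z < 1"
  then have "(norm z)\<^sup>2 < 1" by (simp add: power_less_one_iff abs_square_less_1)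
  then have "(1 - s\<^sup>2) / d * (1 - (norm z)\<^sup>2) < 1 - (norm z)\<^sup>2"
    using q mult_strict_right_mono[of "(1 - s\<^sup>2) / d" 1 "1 - (norm z)\<^sup>2"] by simp
  then have "(norm z)\<^sup>2 < (norm (moebius_ball (s *\<^sub>R u) z))\<^sup>2" using * by linarith
  then show "norm z < norm (moebius_ball (s *\<^sub>R u) z)" by (rule power2_less_imp_less) simp
qed

lemma axis_translate_inner_pos:
  assumes "z \<in> cball 0 1" "0 \<le> z \<bullet> u"
  shows "0 < moebius_ball (s *\<^sub>R u) z \<bullet> u"
proof -
  have "0 \<le> (1 - s\<^sup>2) * (z \<bullet> u)"
    using assms s by (simp add: power_le_one)
  then show ?thesis
    using axis_translate_inner[OF assms(1)] axis_translate_numerator_pos[OF assms(1)]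
      moebius_denom_pos[OF axis_point_in_ball assms(1)] by simp
qed

text \<open>Write z = p u + q with q orthogonal to u. The image is (A u + m q) / d with A > m p, so
  the axial part gains relative to the orthogonal part and the angle to the axis shrinks.\<close>

lemma axis_translate_cos:
  assumes z: "z \<in> cball 0 1" "0 \<le> z \<bullet> u"
  defines "Z \<equiv> moebius_ball (s *\<^sub>R u) z"
  shows "(z \<bullet> u) / norm z \<le> (Z \<bullet> u) / norm Z"
    and "z \<noteq> (z \<bullet> u) *\<^sub>R u \<Longrightarrow> (z \<bullet> u) / norm z < (Z \<bullet> u) / norm Z"
proof -
  define d m p where "d = moebius_denom (s *\<^sub>R u) z" and "m = 1 - s\<^sup>2" and "p = z \<bullet> u"
  define q A where "q = z - p *\<^sub>R u" and "A = m * p + s * (1 + z \<bullet> z + 2 * s * p)"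
  have uu: "u \<bullet> u = 1" using u by (simp add: norm_eq_sqrt_inner)
  have d: "0 < d" using moebius_denom_pos[OF axis_point_in_ball z(1)] by (simp add: d_def)
  have m: "0 < m" using s by (simp add: m_def power_less_one_iff abs_square_less_1)
  have p: "0 \<le> p" using z by (simp add: p_def)
  have mpA: "m * p < A"
    using axis_translate_numerator_pos[OF z(1)] by (simp add: A_def p_def)
  have A: "0 < A" using mpA m p by (smt (verit) mult_nonneg_nonneg)
  have Zu: "Z \<bullet> u = A / d"
    using axis_translate_inner[OF z(1)] by (simp add: Z_def A_def d_def m_def p_def)
  have qu: "q \<bullet> u = 0" by (simp add: q_def p_def inner_diff_left uu)
  have zeq: "z = p *\<^sub>R u + q" by (simp add: q_def)
  have "Z - (Z \<bullet> u) *\<^sub>R u = (m / d) *\<^sub>R q"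
  proof -
    have "Z = ((1 + 2 * s * p + z \<bullet> z) * s / d) *\<^sub>R u + (m / d) *\<^sub>R z"
      unfolding Z_def moebius_ball_def d_def moebius_denom_def m_def p_def power2_norm_eq_inner
      by (simp add: inner_commute[of u z] power2_eq_square uu divide_inverse scaleR_add_right
        mult_ac)
    moreover from this have "Z \<bullet> u = ((1 + 2 * s * p + z \<bullet> z) * s / d) + (m / d) * p"
      by (simp add: inner_add_left uu p_def)
    ultimately show ?thesis by (simp add: q_def algebra_simps)
  qed
  then have Zeq: "Z = (A / d) *\<^sub>R u + (m / d) *\<^sub>R q" by (simp add: Zu algebra_simps)
  have nz: "(norm z)\<^sup>2 = p\<^sup>2 + q \<bullet> q"
    unfolding power2_norm_eq_inner
    by (subst (1 2) zeq) (simp add: inner_add_left inner_add_right uu qu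
        inner_commute[of u q] power2_eq_square)
  have nZ: "(norm Z)\<^sup>2 = (A\<^sup>2 + m\<^sup>2 * (q \<bullet> q)) / d\<^sup>2"
    unfolding power2_norm_eq_inner
    by (subst (1 2) Zeq) (simp add: inner_add_left inner_add_right uu qu
        inner_commute[of u q] power2_eq_square add_divide_distrib)
  have mp2: "(m * p)\<^sup>2 < A\<^sup>2" using mpA m p by (intro power_strict_mono) auto
  have Z0: "0 < norm Z" using Zu A d by auto
  \<comment> \<open>After squaring and cross-multiplying, the two sides share the term (p A)^2, and
    only (m p)^2 < A^2 remains to be used.\<close>
  have nz': "(p * norm Z)\<^sup>2 = ((p * A)\<^sup>2 + (m * p)\<^sup>2 * (q \<bullet> q)) / d\<^sup>2"
    by (simp add: power_mult_distrib nZ algebra_simps)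
  have nZ': "((Z \<bullet> u) * norm z)\<^sup>2 = ((p * A)\<^sup>2 + A\<^sup>2 * (q \<bullet> q)) / d\<^sup>2"
    by (simp add: power_mult_distrib nz Zu power_divide algebra_simps)
  have Zu0: "0 < Z \<bullet> u" using Zu A d by simp
  have "(p * norm Z)\<^sup>2 \<le> ((Z \<bullet> u) * norm z)\<^sup>2"
    unfolding nz' nZ' using mp2 d by (intro divide_right_mono add_left_mono mult_right_mono) auto
  then have "p * norm Z \<le> (Z \<bullet> u) * norm z"
    using Zu0 by - (rule power2_le_imp_le, auto)
  then show "(z \<bullet> u) / norm z \<le> (Z \<bullet> u) / norm Z"
    using Z0 Zu0 by (cases "z = 0") (simp_all add: p_def field_simps)
  assume "z \<noteq> (z \<bullet> u) *\<^sub>R u"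
  then have "0 < q \<bullet> q" "z \<noteq> 0" by (auto simp: q_def p_def)
  then have "(p * norm Z)\<^sup>2 < ((Z \<bullet> u) * norm z)\<^sup>2"
    unfolding nz' nZ' using mp2 d
    by (intro divide_strict_right_mono add_strict_left_mono mult_strict_right_mono) auto
  then have "p * norm Z < (Z \<bullet> u) * norm z"
    using Zu0 by - (rule power2_less_imp_less, auto)
  then show "(z \<bullet> u) / norm z < (Z \<bullet> u) / norm Z"
    using Z0 \<open>z \<noteq> 0\<close> by (simp add: p_def field_simps)
qed

lemma axis_translate_axis:
  "moebius_ball (s *\<^sub>R u) (t *\<^sub>R u) = (moebius_ball (s *\<^sub>R u) (t *\<^sub>R u) \<bullet> u) *\<^sub>R u"
proof -
  obtain r where "moebius_ball (s *\<^sub>R u) (t *\<^sub>R u) = r *\<^sub>R u"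
    using moebius_axis by blast
  then show ?thesis using u by (simp add: norm_eq_1)
qed

text \<open>A fixed point gains nothing, hence the exclusion of \<open>u\<close> from the strict
  statements below.\<close>

lemma axis_translate_end: "moebius_ball (s *\<^sub>R u) u = u"
proof -
  have "moebius_ball (s *\<^sub>R u) u = (((1 + 2 * s + 1) * s + (1 - s\<^sup>2)) / (1 + 2 * s + s\<^sup>2)) *\<^sub>R u"
    using u by (simp add: moebius_ball_def norm_eq_1[THEN iffD1] power_mult_distrib divide_inverse
        scaleR_add_left[symmetric] mult.commute)
  also have "(1 + 2 * s + 1) * s + (1 - s\<^sup>2) = 1 + 2 * s + s\<^sup>2"
    by (simp add: algebra_simps power2_eq_square)
  finally show ?thesis using s by (simp add: add_pos_pos add_pos_nonneg less_imp_neq[symmetric])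
qed

context
  fixes g :: "real \<Rightarrow> real"
  assumes g: "mono_on {0..1} g" "g 0 = 0" "\<And>r. 0 < r \<Longrightarrow> r \<le> 1 \<Longrightarrow> 0 < g r"
begin

text \<open>On this half space \<open>g (norm z)\<close> and the cosine are both nonnegative, and
  neither decreases. Off the axis the cosine increases strictly; on the axis the norm does, unless z
  is the end \<open>u\<close>.\<close>

lemma radial_component_half:
  assumes z: "z \<in> cball 0 1" "0 \<le> z \<bullet> u"
  defines "Z \<equiv> moebius_ball (s *\<^sub>R u) z"
  shows "radial_component g u z \<le> radial_component g u Z"
    and "z \<noteq> (z \<bullet> u) *\<^sub>R u \<or> strict_mono_on {0..1} g \<and> z \<noteq> u \<Longrightarrow>
      radial_component g u z < radial_component g u Z"
proof -
  have Z: "Z \<in> cball 0 1"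
    using moebius_in_cball[OF axis_point_in_ball z(1)] by (simp add: Z_def)
  have Zu: "0 < Z \<bullet> u" using axis_translate_inner_pos[OF z] by (simp add: Z_def)
  then have Z0: "Z \<noteq> 0" by auto
  have nz: "norm z \<le> norm Z" using axis_translate_norm(1)[OF z] by (simp add: Z_def)
  have gz: "g (norm z) \<le> g (norm Z)"
    using nz z(1) Z by (intro mono_onD[OF g(1)]) auto
  have gZ: "0 < g (norm Z)" using g(3) Z Z0 by simp
  have gz0: "0 \<le> g (norm z)" using g(2) g(3)[of "norm z"] z(1) by (cases "z = 0") auto
  have c: "(z \<bullet> u) / norm z \<le> (Z \<bullet> u) / norm Z"
    using axis_translate_cos(1)[OF z] by (simp add: Z_def)
  have c0: "0 \<le> (z \<bullet> u) / norm z" using z by simp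
  have cZ: "0 < (Z \<bullet> u) / norm Z" using Zu Z0 by simp
  show "radial_component g u z \<le> radial_component g u Z"
    unfolding radial_component_def using gz c c0 gZ by (intro mult_mono) auto
  assume strict: "z \<noteq> (z \<bullet> u) *\<^sub>R u \<or> strict_mono_on {0..1} g \<and> z \<noteq> u"
  show "radial_component g u z < radial_component g u Z"
  proof (cases "z = (z \<bullet> u) *\<^sub>R u")
    case False
    have "radial_component g u z \<le> g (norm Z) * ((z \<bullet> u) / norm z)"
      unfolding radial_component_def using gz c0 by (rule mult_right_mono)
    also have "\<dots> < radial_component g u Z"
      using mult_strict_left_mono[OF axis_translate_cos(2)[OF z False] gZ[unfolded Z_def]]
      unfolding radial_component_def Z_def .
    finally show ?thesis .
  next
    case True
    then have sg: "strict_mono_on {0..1} g" and zu: "z \<noteq> u" using strict by auto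
    \<comment> \<open>On the nonnegative half of the axis, norm 1 is attained only at
      \<open>u\<close>.\<close>
    have nzu: "norm z = z \<bullet> u"
      using z(2) u by (subst True) simp
    then have "norm z < 1"
      using True zu z(1) by (metis less_eq_real_def mem_cball_0 scaleR_one)
    then have "norm z < norm Z"
      using axis_translate_norm(2)[OF z] by (simp add: Z_def)
    then have "g (norm z) < g (norm Z)"
      using z(1) Z by (intro strict_mono_onD[OF sg]) auto
    have "radial_component g u z \<le> g (norm z) * ((Z \<bullet> u) / norm Z)"
      unfolding radial_component_def using c gz0 by (rule mult_left_mono)
    also have "\<dots> < radial_component g u Z"
      unfolding radial_component_def
      using \<open>g (norm z) < g (norm Z)\<close> cZ by (rule mult_strict_right_mono)
    finally show ?thesis .
  qed
qed

text \<open>The component along \<open>u\<close> is odd, so the half space \<open>z \<bullet> u \<le> 0\<close> reduces to the other one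
  by running the translation backwards.\<close>

lemma radial_component_axis_translate:
  assumes z: "z \<in> cball 0 1"
  defines "Z \<equiv> moebius_ball (s *\<^sub>R u) z"
  shows "radial_component g u z \<le> radial_component g u Z"
    and "z \<noteq> (z \<bullet> u) *\<^sub>R u \<or> strict_mono_on {0..1} g \<and> z \<noteq> u \<and> z \<noteq> - u \<Longrightarrow>
      radial_component g u z < radial_component g u Z"
proof -
  have Z: "Z \<in> cball 0 1"
    using moebius_in_cball[OF axis_point_in_ball z] by (simp add: Z_def)
  consider (pos) "0 \<le> z \<bullet> u" | (neg) "Z \<bullet> u \<le> 0" | (mix) "z \<bullet> u < 0" "0 < Z \<bullet> u"
    by linarith
  then have "radial_component g u z \<le> radial_component g u Z \<and>
    (z \<noteq> (z \<bullet> u) *\<^sub>R u \<or> strict_mono_on {0..1} g \<and> z \<noteq> u \<and> z \<noteq> - u \<longrightarrow>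
      radial_component g u z < radial_component g u Z)"
  proof cases
    case pos
    then show ?thesis using radial_component_half[OF z] by (auto simp: Z_def)
  next
    case neg
    \<comment> \<open>\<open>- Z\<close> lies in the nonnegative half space and is carried to
      \<open>- z\<close>.\<close>
    have inv: "moebius_ball (s *\<^sub>R u) (- Z) = - z"
      using moebius_inverse[OF axis_point_in_ball z] moebius_uminus[of "- (s *\<^sub>R u)" Z]
      by (simp add: Z_def)
    have *: "- Z \<in> cball 0 1" "0 \<le> - Z \<bullet> u" using Z neg by simp_all
    have "z = (z \<bullet> u) *\<^sub>R u" if "- Z = (- Z \<bullet> u) *\<^sub>R u"
      using axis_translate_axis[of "- Z \<bullet> u"] inv that
      by (metis inner_minus_left minus_equation_iff scaleR_minus_left)
    moreover have "z = - u" if "- Z = u"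
      using inv that axis_translate_end by (metis minus_equation_iff)
    ultimately show ?thesis
      using radial_component_half[OF *] unfolding inv by auto
  next
    \<comment> \<open>The point crosses the hyperplane orthogonal to \<open>u\<close>, so the signs
      alone give strict increase.\<close>
    case mix
    then have "z \<noteq> 0" "Z \<noteq> 0" by auto
    then have "radial_component g u z < 0" "0 < radial_component g u Z"
      unfolding radial_component_def using mix g(3) z Z
      by (simp_all add: mult_pos_neg divide_neg_pos)
    then show ?thesis by linarith
  qed
  then show "radial_component g u z \<le> radial_component g u Z"
    and "z \<noteq> (z \<bullet> u) *\<^sub>R u \<or> strict_mono_on {0..1} g \<and> z \<noteq> u \<and> z \<noteq> - u \<Longrightarrow>
      radial_component g u z < radial_component g u Z"
    by blast+
qed

end
end

section \<open>Geodesics and uniqueness\<close>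

text \<open>The plane of the circle contains the origin and |c|^2 = 1 + r^2, so by the converse of
  Pythagoras the radius at a common point p is perpendicular to p. Within the plane, p is then
  parallel to the tangent.\<close>

lemma circle_orthogonal_to_sphere:
  fixes a b :: "real^'n"
  assumes ab: "norm a = 1" "norm b = 1" "a \<bullet> b = 0"
    and c: "c = c1 *\<^sub>R a + c2 *\<^sub>R b" "c1\<^sup>2 + c2\<^sup>2 = 1 + r\<^sup>2" and r: "0 < r"
    and p: "circle_point c r a b t \<in> sphere 0 1"
    and w: "w \<bullet> circle_point c r a b t = 0"
  shows "w \<bullet> circle_tangent a b t = 0"
proof -
  have ab': "a \<bullet> a = 1" "b \<bullet> b = 1" "b \<bullet> a = 0" using ab by (simp_all add: norm_eq_1 inner_commute)
  \<comment> \<open>\<open>m\<close> is the inner product of the point with the unit tangent. The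
    fact \<open>rr\<close> below says that the inner product with the radius direction
    vanishes.\<close>
  define C S m where "C = cos t" and "S = sin t" and "m = c2 * C - c1 * S"
  have CS: "C\<^sup>2 + S\<^sup>2 = 1" by (simp add: C_def S_def)
  have pt: "circle_point c r a b t = (c1 + r * C) *\<^sub>R a + (c2 + r * S) *\<^sub>R b"
    by (simp add: circle_point_def c C_def S_def algebra_simps)
  have "(c1 + r * C)\<^sup>2 + (c2 + r * S)\<^sup>2 = 1"
    using p unfolding in_sphere_iff_inner pt
    by (simp add: inner_add_left inner_add_right ab' ab(3) power2_eq_square)
  also have "(c1 + r * C)\<^sup>2 + (c2 + r * S)\<^sup>2 = (c1\<^sup>2 + c2\<^sup>2) + 2 * r * (c1 * C + c2 * S) + r\<^sup>2 * (C\<^sup>2 + S\<^sup>2)"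
    by (simp add: power2_eq_square algebra_simps)
  finally have "2 * r * (c1 * C + c2 * S + r) = 0"
    unfolding c(2) CS by (simp add: power2_eq_square algebra_simps)
  then have rr: "c1 * C + c2 * S = - r" using r by simp
  have "m\<^sup>2 + (c1 * C + c2 * S)\<^sup>2 = (c1\<^sup>2 + c2\<^sup>2) * (C\<^sup>2 + S\<^sup>2)"
    by (simp add: m_def power2_eq_square algebra_simps)
  then have m2: "m\<^sup>2 = 1" by (simp add: rr CS c(2))
  have "c1 + r * C = c1 * (C\<^sup>2 + S\<^sup>2) - (c1 * C + c2 * S) * C"
    by (simp add: rr CS)
  also have "\<dots> = - m * S" by (simp add: m_def power2_eq_square algebra_simps)
  finally have 1: "c1 + r * C = - m * S" .
  have "c2 + r * S = c2 * (C\<^sup>2 + S\<^sup>2) - (c1 * C + c2 * S) * S"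
    by (simp add: rr CS)
  also have "\<dots> = m * C" by (simp add: m_def power2_eq_square algebra_simps)
  finally have 2: "c2 + r * S = m * C" .
  have "circle_point c r a b t = m *\<^sub>R circle_tangent a b t"
    unfolding pt 1 2 circle_tangent_def C_def[symmetric] S_def[symmetric] by (simp add: scaleR_diff_right)
  then show ?thesis using w m2 by auto
qed

lemma continuous_on_moebius:
  "continuous_on (ball 0 1 \<times> cball (0 :: real^'n) 1) (\<lambda>(x, y). moebius_ball x y)"
  unfolding moebius_ball_def case_prod_beta
proof (intro continuous_intros)
  show "\<forall>p\<in>ball 0 1 \<times> cball (0 :: real^'n) 1. 1 + 2 * (fst p \<bullet> snd p) + (norm (fst p))\<^sup>2 * (norm (snd p))\<^sup>2 \<noteq> 0"
  proof
    fix p :: "(real^'n) \<times> (real^'n)"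
    assume "p \<in> ball 0 1 \<times> cball 0 1"
    then have "0 < moebius_denom (fst p) (snd p)"
      by (intro moebius_denom_pos) auto
    then show "1 + 2 * (fst p \<bullet> snd p) + (norm (fst p))\<^sup>2 * (norm (snd p))\<^sup>2 \<noteq> 0"
      by (simp add: moebius_denom_def power2_norm_eq_inner)
  qed
qed

lemma continuous_on_moebius_right:
  assumes "x \<in> ball 0 1"
  shows "continuous_on (cball 0 1) (moebius_ball x)"
proof -
  have "continuous_on (cball 0 1) (\<lambda>y. (\<lambda>(x, y). moebius_ball x y) (x, y))"
    using assms by (intro continuous_on_compose2[OF continuous_on_moebius] continuous_intros) auto
  then show ?thesis by simp
qed

text \<open>The preimage of the closed axis is its image under T_(-x). This is a diameter if x is
  parallel to u, and otherwise an arc of a circle orthogonal to the sphere, in the plane of x and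
  u.\<close>

lemma moebius_axis_pullback_in_geodesic:
  fixes x u :: "real^'n"
  assumes x: "x \<in> ball 0 1" and u: "norm u = 1"
  obtains \<gamma> where "hyperbolic_geodesic \<gamma>"
    and "\<And>y. y \<in> cball 0 1 \<Longrightarrow> moebius_ball x y = (moebius_ball x y \<bullet> u) *\<^sub>R u \<Longrightarrow> y \<in> closure \<gamma>"
proof -
  define f where "f = (\<lambda>t. moebius_ball (- x) (t *\<^sub>R u))"
  have uu: "u \<bullet> u = 1" using u by (simp add: norm_eq_1)
  have mx: "- x \<in> ball 0 1" using x by simp
  have f_ball: "f t \<in> ball 0 1" if "- 1 < t" "t < 1" for t
    unfolding f_def using mx u that by (intro moebius_in_ball) auto
  have closure: "y \<in> closure \<gamma>"
    if sub: "f ` {-1<..<1} \<subseteq> \<gamma>" and y: "y \<in> cball 0 1"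
      and ax: "moebius_ball x y = (moebius_ball x y \<bullet> u) *\<^sub>R u" for y \<gamma>
  proof -
    define t where "t = moebius_ball x y \<bullet> u"
    have "\<bar>t\<bar> \<le> norm (moebius_ball x y)"
      using Cauchy_Schwarz_ineq2[of "moebius_ball x y" u] u by (simp add: t_def)
    also have "\<dots> \<le> 1" using moebius_in_cball[OF x y] by simp
    finally have t: "t \<in> {-1..1}" by auto
    have cl: "closure {-1<..<1::real} = {-1..1}" by simp
    \<comment> \<open>Only the open segment is mapped into the geodesic; the parameters 1 and -1 are
      reached by continuity.\<close>
    have "continuous_on {-1..1} f"
      unfolding f_def using u
      by (intro continuous_on_compose2[OF continuous_on_moebius_right[OF mx]] continuous_intros) auto
    then have "f ` closure {-1<..<1} \<subseteq> closure \<gamma>"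
      unfolding cl using sub closure_subset[of \<gamma>]
      by (intro image_closure_subset[of "{-1<..<1}" f "closure \<gamma>", unfolded cl]) auto
    moreover have "y = f t"
      using moebius_inverse[OF x y] ax by (simp add: f_def t_def)
    ultimately show ?thesis using t unfolding cl by auto
  qed
  define al where "al = x \<bullet> u"
  define w where "w = x - al *\<^sub>R u"
  show ?thesis
  proof (cases "w = 0")
    case True
    define \<gamma> where "\<gamma> = {t *\<^sub>R u | t. -1 < t \<and> t < 1}"
    have "f ` {-1<..<1} \<subseteq> \<gamma>"
    proof clarify
      fix t :: real assume t: "t \<in> {-1<..<1}"
      have "- x = (- al) *\<^sub>R u" using True by (simp add: w_def)
      then obtain r where r: "f t = r *\<^sub>R u"
        using moebius_axis[of "- al" u t] by (auto simp: f_def)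
      then have "\<bar>r\<bar> < 1" using f_ball[of t] t u by (simp add: dist_norm)
      then show "f t \<in> \<gamma>" using r by (auto simp: \<gamma>_def)
    qed
    moreover have "hyperbolic_geodesic \<gamma>" using u by (auto simp: hyperbolic_geodesic_def \<gamma>_def)
    ultimately show ?thesis using closure that by blast
  next
    case False
    define W k where "W = w \<bullet> w" and "k = x \<bullet> x"
    have W: "0 < W" using False by (simp add: W_def)
    have wu: "w \<bullet> u = 0" "u \<bullet> w = 0"
      by (simp_all add: w_def al_def inner_diff_left inner_diff_right uu inner_commute)
    have xw: "x = al *\<^sub>R u + w" by (simp add: w_def)
    have k: "k = al\<^sup>2 + W"
      unfolding k_def by (subst (1 2) xw)
        (simp add: inner_add_left inner_add_right uu wu W_def power2_eq_square)
    have k1: "k < 1" using x unfolding in_ball_iff_inner k_def .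
    have k0: "0 < k" using W k by (simp add: add_nonneg_pos)
    text \<open>The centre is determined by \<open>2 (c \<bullet> p) = 1 + p \<bullet> p\<close> for all points \<open>p = f t\<close>.\<close>
    define be where "be = (1 + W - al\<^sup>2) / (2 * W)"
    define c where "c = - al *\<^sub>R u - be *\<^sub>R w"
    have cx: "c \<bullet> x = - (1 + k) / 2"
    proof -
      have "c \<bullet> x = - al\<^sup>2 - be * W"
        by (subst xw) (simp add: c_def inner_add_left inner_diff_left inner_add_right uu wu W_def
            power2_eq_square)
      also have "be * W = (1 + W - al\<^sup>2) / 2" using W by (simp add: be_def)
      finally show ?thesis by (simp add: k field_simps)
    qed
    have cu: "c \<bullet> u = - al" by (simp add: c_def inner_diff_left uu wu)
    have cc: "c \<bullet> c = al\<^sup>2 + (be * sqrt W)\<^sup>2"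
      using W by (simp add: c_def inner_diff_left inner_diff_right uu wu power2_eq_square W_def)
    \<comment> \<open>Together with Cauchy-Schwarz this gives |c| > 1, so that the radius sqrt
      (|c|^2 - 1), dictated by orthogonality to the unit sphere, is positive.\<close>
    have "k < (c \<bullet> x)\<^sup>2"
    proof -
      have "0 < (1 - k)\<^sup>2" using k1 by simp
      then show ?thesis by (simp add: cx power2_eq_square algebra_simps)
    qed
    also have "(c \<bullet> x)\<^sup>2 \<le> (c \<bullet> c) * k" unfolding k_def by (rule Cauchy_Schwarz_ineq)
    finally have cc1: "1 < c \<bullet> c" using k0 by simp
    define r where "r = sqrt (c \<bullet> c - 1)"
    have r: "0 < r" "r\<^sup>2 = c \<bullet> c - 1" using cc1 by (simp_all add: r_def)
    define b where "b = w /\<^sub>R sqrt W"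
    have b: "norm b = 1" "u \<bullet> b = 0"
      using False wu by (simp_all add: b_def W_def flip: norm_eq_sqrt_inner)
    have bw: "w = sqrt W *\<^sub>R b" using W by (simp add: b_def)
    have c_b: "c = (- al) *\<^sub>R u + (- (be * sqrt W)) *\<^sub>R b"
      using bw by (simp add: c_def)
    have bb: "b \<bullet> b = 1" using b by (simp add: norm_eq_1)
    have circle: "f t \<in> range (circle_point c r u b)" if t: "- 1 \<le> t" "t \<le> 1" for t
    proof -
      define p d where "p = f t" and "d = moebius_denom (- x) (t *\<^sub>R u)"
      have tu: "t *\<^sub>R u \<in> cball 0 1" using t u by simp
      have d: "0 < d" unfolding d_def by (rule moebius_denom_pos[OF mx tu])
      have d': "d = 1 - 2 * t * al + k * t\<^sup>2"
        by (simp add: d_def moebius_denom_def k_def al_def uu power2_eq_square)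
      have pp: "d * (p \<bullet> p) = d - (1 - k) * (1 - t\<^sup>2)"
        using one_minus_moebius_inner[of "- x" "t *\<^sub>R u"] d
        by (simp add: p_def f_def d_def[symmetric] k_def uu power2_eq_square field_simps)
      have dp: "d *\<^sub>R p = ((1 - k) * t) *\<^sub>R u - (1 - 2 * t * al + t\<^sup>2) *\<^sub>R x"
        using d unfolding p_def f_def moebius_ball_def power2_norm_eq_inner
        by (simp add: d' k_def al_def uu power2_eq_square mult_ac scaleR_diff_left scaleR_add_left)
      have "d * (c \<bullet> p) = c \<bullet> (d *\<^sub>R p)" by simp
      also have "\<dots> = ((1 - k) * t) * (c \<bullet> u) - (1 - 2 * t * al + t\<^sup>2) * (c \<bullet> x)"
        unfolding dp by (simp only: inner_diff_right inner_scaleR_right)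
      also have "\<dots> = d * (1 + p \<bullet> p) / 2"
        unfolding distrib_left pp cx cu
        by (simp add: d' field_simps power2_eq_square)
      finally have "d * (c \<bullet> p) = d * ((1 + p \<bullet> p) / 2)" by simp
      then have cp: "c \<bullet> p = (1 + p \<bullet> p) / 2" using d by (simp only: mult_cancel_left) simp
      \<comment> \<open>p is a combination of u and x, hence lies in the plane of u and b.\<close>
      obtain A B where AB: "p = A *\<^sub>R u + B *\<^sub>R b"
      proof
        have "p = inverse d *\<^sub>R (d *\<^sub>R p)" using d by simp
        also have "\<dots> = (inverse d * ((1 - k) * t - (1 - 2 * t * al + t\<^sup>2) * al)) *\<^sub>R u
            + (inverse d * (- (1 - 2 * t * al + t\<^sup>2) * sqrt W)) *\<^sub>R b"
          unfolding dp by (subst xw, subst bw) (simp add: algebra_simps)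
        finally show "p = (inverse d * ((1 - k) * t - (1 - 2 * t * al + t\<^sup>2) * al)) *\<^sub>R u
            + (inverse d * (- (1 - 2 * t * al + t\<^sup>2) * sqrt W)) *\<^sub>R b" .
      qed
      \<comment> \<open>Since r^2 = c . c - 1, this is the relation 2 (c . p) = 1 + p . p.\<close>
      have rp: "(p - c) \<bullet> (p - c) = r\<^sup>2"
        using cp by (simp add: r inner_diff_left inner_diff_right inner_commute)
      have pc: "p - c = (A + al) *\<^sub>R u + (B + be * sqrt W) *\<^sub>R b"
        by (simp add: AB c_b algebra_simps)
      have "(A + al)\<^sup>2 + (B + be * sqrt W)\<^sup>2 = r\<^sup>2"
        unfolding rp[symmetric] pc
        by (simp add: inner_add_left inner_add_right uu bb b inner_commute[of b u] power2_eq_square)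
      then have "((A + al) / r)\<^sup>2 + ((B + be * sqrt W) / r)\<^sup>2 = 1"
        using r(1) by (simp add: power_divide flip: add_divide_distrib)
      then obtain th where "(A + al) / r = cos th" "(B + be * sqrt W) / r = sin th"
        using sincos_total_2pi by metis
      then have "A + al = r * cos th" "B + be * sqrt W = r * sin th"
        using r(1) by (simp_all add: field_simps)
      then have "p = circle_point c r u b th"
        using pc by (simp add: circle_point_def algebra_simps)
      then show ?thesis by (simp add: p_def)
    qed
    define \<gamma> where "\<gamma> = range (circle_point c r u b) \<inter> ball 0 1"
    have "f ` {-1<..<1} \<subseteq> \<gamma>"
      using circle f_ball by (auto simp: \<gamma>_def)
    moreover have "meets_sphere_at_right_angles c r u b"
      unfolding meets_sphere_at_right_angles_def
    proof (intro conjI allI impI)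
      \<comment> \<open>An endpoint of the arc supplies a common point of circle and sphere.\<close>
      have "f 1 \<in> sphere 0 1"
        unfolding f_def using mx u by (intro moebius_in_sphere) auto
      then show "\<exists>t. circle_point c r u b t \<in> sphere 0 1" using circle[of 1] by auto
    next
      fix t v
      assume "circle_point c r u b t \<in> sphere 0 1" "v \<bullet> circle_point c r u b t = 0"
      with circle_orthogonal_to_sphere[OF u b c_b _ r(1)]
      show "v \<bullet> circle_tangent u b t = 0" using cc r(2) by simp
    qed
    then have "hyperbolic_geodesic \<gamma>"
      unfolding hyperbolic_geodesic_def \<gamma>_def using r(1) u b by blast
    ultimately show ?thesis using closure that by blast
  qed
qed

text \<open>Away from 0 the formula is visibly continuous; at 0 the norm of the field is at most
  |g(|y|)|, which tends to g 0 = 0.\<close>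

lemma continuous_on_radial_field:
  assumes g: "continuous_on {0..1} g" "g 0 = 0"
  shows "continuous_on (cball 0 1) (radial_field g :: real^'n \<Rightarrow> real^'n)"
proof -
  define h :: "real^'n \<Rightarrow> real^'n" where "h = (\<lambda>y. g (norm y) *\<^sub>R (y /\<^sub>R norm y))"
  have h: "radial_field g = h" by (auto simp: h_def radial_field_def)
  have gn: "continuous_on (cball 0 1) (\<lambda>y::real^'n. g (norm y))"
    by (intro continuous_on_compose2[OF g(1)] continuous_intros) auto
  have h0: "continuous_on (cball 0 1 - {0}) h"
    unfolding h_def
    by (intro continuous_intros continuous_on_subset[OF gn]) auto
  have "continuous (at y within cball 0 1) h" if y: "y \<in> cball 0 1" for y
  proof (cases "y = 0")
    case False
    then have "continuous (at y within (cball 0 1 - {0})) h"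
      using h0 y by (simp add: continuous_on_eq_continuous_within)
    moreover have "at y within (cball 0 1 - {0}) = at y within cball 0 1"
      using False by (intro at_within_nhd[of y "- {0}"]) auto
    ultimately show ?thesis by simp
  next
    case True
    have "((\<lambda>y. g (norm y)) \<longlongrightarrow> g (norm (0::real^'n))) (at (0::real^'n) within cball 0 1)"
      using gn unfolding continuous_on_def by (rule bspec) simp
    then have lim: "((\<lambda>y. \<bar>g (norm y)\<bar>) \<longlongrightarrow> 0) (at (0::real^'n) within cball 0 1)"
      using g(2) by (simp add: tendsto_rabs_zero)
    have "norm (h y) \<le> \<bar>g (norm y)\<bar>" for y
      by (cases "y = 0") (simp_all add: h_def g(2) abs_mult mult.assoc)
    then have "(h \<longlongrightarrow> 0) (at 0 within cball 0 1)"
      by (intro Lim_null_comparison[OF always_eventually lim]) simp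
    then show ?thesis using True by (simp add: continuous_within h_def)
  qed
  then show ?thesis by (simp add: h continuous_on_eq_continuous_within)
qed

lemma continuous_on_radial_field_moebius:
  assumes "continuous_on {0..1} g" "g 0 = 0" "x \<in> ball 0 1"
  shows "continuous_on (cball 0 1) (\<lambda>y. radial_field g (moebius_ball x y))"
  using moebius_in_cball[OF assms(3)]
  by (intro continuous_on_compose2[OF continuous_on_radial_field[OF assms(1,2)]
      continuous_on_moebius_right[OF assms(3)]]) blast

section \<open>Integration against finite Borel measures on the closed ball\<close>

lemma finite_borel_measure_cballD:
  fixes M :: "(real^'n) measure"
  assumes "finite_borel_measure_cball M"
  shows "space M = cball 0 1" "finite_measure M" "0 < measure M (cball 0 1)"
    "sets M = sets (restrict_space borel (cball 0 1))"
proof -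
  show s: "sets M = sets (restrict_space borel (cball 0 1))"
    using assms by (simp add: finite_borel_measure_cball_def)
  show sp: "space M = cball 0 1"
    using sets_eq_imp_space_eq[OF s] by (simp add: space_restrict_space)
  have em: "0 < emeasure M (cball 0 1)" "emeasure M (cball 0 1) < \<infinity>"
    using assms by (simp_all add: finite_borel_measure_cball_def)
  show "finite_measure M"
    using em(2) by (intro finite_measureI) (simp add: sp less_top)
  show "0 < measure M (cball 0 1)"
    using em by (simp add: measure_def enn2real_positive_iff)
qed

lemma in_sets_cball:
  fixes M :: "(real^'n) measure"
  assumes "finite_borel_measure_cball M" "A \<in> sets borel" "A \<subseteq> cball 0 1"
  shows "A \<in> sets M"
  using assms finite_borel_measure_cballD(4)[OF assms(1)] by (auto simp: sets_restrict_space)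

lemma borel_measurable_cball:
  fixes M :: "(real^'n) measure" and f :: "real^'n \<Rightarrow> 'b::topological_space"
  assumes "finite_borel_measure_cball M" "continuous_on (cball 0 1) f"
  shows "f \<in> borel_measurable M"
proof -
  have "f \<in> borel_measurable (restrict_space borel (cball 0 1))"
    using assms(2) by (rule borel_measurable_continuous_on_restrict)
  then show ?thesis
    using measurable_cong_sets[OF finite_borel_measure_cballD(4)[OF assms(1)] refl] by blast
qed

lemma integrable_cball:
  fixes M :: "(real^'n) measure" and f :: "real^'n \<Rightarrow> 'b::euclidean_space"
  assumes M: "finite_borel_measure_cball M" and f: "continuous_on (cball 0 1) f"
  shows "integrable M f"
proof -
  interpret finite_measure M using finite_borel_measure_cballD(2)[OF M] .
  have "bounded (f ` cball 0 1)"
    by (rule compact_imp_bounded[OF compact_continuous_image[OF f compact_cball]])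
  then obtain B where "\<forall>y \<in> space M. norm (f y) \<le> B"
    unfolding finite_borel_measure_cballD(1)[OF M] bounded_iff by auto
  then have "AE y in M. norm (f y) \<le> B" by simp
  then show ?thesis using borel_measurable_cball[OF M f] by (rule integrable_const_bound)
qed

text \<open>Reduces the vector equation V(x) = 0 to scalar integrals, to which pointwise comparison
  applies.\<close>

lemma moebius_average_inner:
  fixes M :: "(real^'n) measure"
  assumes M: "finite_borel_measure_cball M" and g: "continuous_on {0..1} g" "g 0 = 0"
    and x: "x \<in> ball 0 1"
  shows "integrable M (\<lambda>y. radial_component g e (moebius_ball x y))"
    and "moebius_average g M x \<bullet> e = (\<integral>y. radial_component g e (moebius_ball x y) \<partial>M)"
proof -
  have i: "integrable M (\<lambda>y. radial_field g (moebius_ball x y))"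
    using M continuous_on_radial_field_moebius[OF g x] by (rule integrable_cball)
  show "integrable M (\<lambda>y. radial_component g e (moebius_ball x y))"
    using i unfolding radial_field_inner[symmetric] by (rule integrable_inner_left)
  show "moebius_average g M x \<bullet> e = (\<integral>y. radial_component g e (moebius_ball x y) \<partial>M)"
    unfolding radial_field_inner[symmetric] moebius_average_def
    using integral_inner_left[of e M, OF i] by simp
qed

text \<open>Translating \<open>x1\<close> to the origin places \<open>x2\<close> on the axis \<open>u\<close>; along that axis the component
  of the field in direction \<open>u\<close> increases pointwise.\<close>

lemma moebius_average_two_zeros:
  fixes M :: "(real^'n) measure"
  assumes M: "finite_borel_measure_cball M" and g: "continuous_on {0..1} g" "g 0 = 0"
    and mono: "mono_on {0..1} g" and pos: "\<And>r. 0 < r \<Longrightarrow> r \<le> 1 \<Longrightarrow> 0 < g r"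
    and x: "x1 \<in> ball 0 1" "x2 \<in> ball 0 1" "x1 \<noteq> x2"
    and V: "moebius_average g M x1 = 0" "moebius_average g M x2 = 0"
  obtains u where "norm u = 1"
    and "AE y in M. moebius_ball x1 y = (moebius_ball x1 y \<bullet> u) *\<^sub>R u \<and>
      (strict_mono_on {0..1} g \<longrightarrow> moebius_ball x1 y = u \<or> moebius_ball x1 y = - u)"
proof -
  define w where "w = moebius_ball (- x1) x2"
  have w: "w \<in> ball 0 1"
    unfolding w_def using x by (intro moebius_in_ball) auto
  have w0: "w \<noteq> 0"
    using moebius_inverse'[of x1 x2] x by (auto simp: w_def)
  define s u where "s = norm w" and "u = w /\<^sub>R norm w"
  have s: "0 < s" "s < 1" and u: "norm u = 1" and wsu: "w = s *\<^sub>R u"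
    using w w0 by (simp_all add: s_def u_def)
  \<comment> \<open>By construction T at \<open>x2\<close> is \<open>S\<close> after
    \<open>P\<close>. As \<open>S\<close> preserves inner products, the component of T_(x2)(y) along
    \<open>S u\<close> equals that of \<open>P y\<close> along \<open>u\<close>.\<close>
  define S where "S = (\<lambda>z. moebius_ball x2 (moebius_ball (- x1) (moebius_ball (- w) z)))"
  define P where "P = (\<lambda>y. moebius_ball w (moebius_ball x1 y))"
  have SS: "S z \<bullet> S z' = z \<bullet> z'" if "z \<in> cball 0 1" "z' \<in> cball 0 1" for z z'
    using moebius_composition_inner[OF x(1,2) that] by (simp add: S_def w_def)
  have uc: "u \<in> cball 0 1" using u by simp
  have rc: "radial_component g (S u) (moebius_ball x2 y) = radial_component g u (P y)"
    if y: "y \<in> cball 0 1" for y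
  proof -
    have y1: "moebius_ball x1 y \<in> cball 0 1" using moebius_in_cball[OF x(1) y] .
    have Py: "P y \<in> cball 0 1" unfolding P_def using moebius_in_cball[OF w y1] .
    have "S (P y) = moebius_ball x2 y"
      unfolding S_def P_def moebius_inverse[OF w y1] moebius_inverse[OF x(1) y] ..
    moreover have "norm (S (P y)) = norm (P y)"
      using SS[OF Py Py] by (simp add: norm_eq)
    ultimately show ?thesis
      using SS[OF Py uc] by (simp add: radial_component_def)
  qed
  \<comment> \<open>The two directions differ, but both integrals vanish because the whole vectors V
    do. So \<open>F\<close>, pointwise nonnegative, has integral zero and is zero almost
    everywhere.\<close>
  define F where "F = (\<lambda>y. radial_component g (S u) (moebius_ball x2 y) - radial_component g u (moebius_ball x1 y))"
  have iF: "integrable M F"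
    unfolding F_def using moebius_average_inner(1)[OF M g] x by (intro Bochner_Integration.integrable_diff) auto
  have F0: "(\<integral>y. F y \<partial>M) = 0"
    unfolding F_def using moebius_average_inner[OF M g] x V
    by (subst Bochner_Integration.integral_diff) (auto simp flip: moebius_average_inner(2)[OF M g])
  have step: "radial_component g u z \<le> radial_component g u (moebius_ball w z)"
    "z \<noteq> (z \<bullet> u) *\<^sub>R u \<or> strict_mono_on {0..1} g \<and> z \<noteq> u \<and> z \<noteq> - u \<Longrightarrow>
      radial_component g u z < radial_component g u (moebius_ball w z)" if "z \<in> cball 0 1" for z
    using radial_component_axis_translate[OF u s mono g(2) _ that] pos wsu by auto
  have Fge: "0 \<le> F y" if "y \<in> cball 0 1" for y
    using step(1)[OF moebius_in_cball[OF x(1) that]] rc[OF that]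
    by (simp add: F_def P_def)
  have Feq: "moebius_ball x1 y = (moebius_ball x1 y \<bullet> u) *\<^sub>R u \<and>
      (strict_mono_on {0..1} g \<longrightarrow> moebius_ball x1 y = u \<or> moebius_ball x1 y = - u)"
    if "y \<in> cball 0 1" "F y = 0" for y
    using step(2)[OF moebius_in_cball[OF x(1) that(1)]] rc[OF that(1)] that(2)
    by (auto simp: F_def P_def)
  have sp: "space M = cball 0 1" using finite_borel_measure_cballD(1)[OF M] .
  have "AE y in M. 0 \<le> F y" using Fge by (intro AE_I2) (simp add: sp)
  then have "AE y in M. F y = 0"
    using integral_nonneg_eq_0_iff_AE[OF iF] F0 by simp
  then have "AE y in M. moebius_ball x1 y = (moebius_ball x1 y \<bullet> u) *\<^sub>R u \<and>
      (strict_mono_on {0..1} g \<longrightarrow> moebius_ball x1 y = u \<or> moebius_ball x1 y = - u)"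
    using AE_space by eventually_elim (use Feq sp in auto)
  with u show ?thesis by (rule that)
qed

text \<open>The alternative of (i) and (ii) for a single measure, so that the limit measure and each
  approximating one can be treated alike.\<close>

definition admissible :: "(real \<Rightarrow> real) \<Rightarrow> (real^'n) measure \<Rightarrow> bool" where
  "admissible g M \<longleftrightarrow> condition_i g \<or> condition_ii g M"

lemma admissible_mono:
  assumes "admissible g M" "g 0 = 0"
  shows "mono_on {0..1} g" "0 < r \<Longrightarrow> r \<le> 1 \<Longrightarrow> 0 < g r"
proof -
  show m: "mono_on {0..1} g"
    using assms strict_mono_on_imp_mono_on
    by (auto simp: admissible_def condition_i_def condition_ii_def)
  assume r: "0 < r" "r \<le> 1"
  show "0 < g r"
    using assms(1) unfolding admissible_def
  proof
    assume "condition_i g"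
    then show ?thesis
      using strict_mono_onD[of "{0..1}" g 0 r] r assms(2) by (simp add: condition_i_def)
  next
    assume "condition_ii g M"
    \<comment> \<open>Condition (ii) gives positivity only below 1; passing through r / 2 reaches r
      = 1.\<close>
    then have "0 < g (r / 2)" using r by (simp add: condition_ii_def)
    also have "\<dots> \<le> g r" using r by (intro mono_onD[OF m]) auto
    finally show ?thesis .
  qed
qed

lemma moebius_average_zero_unique:
  fixes M :: "(real^'n) measure"
  assumes M: "finite_borel_measure_cball M" "point_mass_condition M"
    and g: "continuous_on {0..1} g" "g 0 = 0" and adm: "admissible g M"
    and x: "x1 \<in> ball 0 1" "x2 \<in> ball 0 1"
    and V: "moebius_average g M x1 = 0" "moebius_average g M x2 = 0"
  shows "x1 = x2"
proof (rule ccontr)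
  assume ne: "x1 \<noteq> x2"
  interpret finite_measure M using finite_borel_measure_cballD(2)[OF M(1)] .
  have sp: "space M = cball 0 1" using finite_borel_measure_cballD(1)[OF M(1)] .
  obtain u where u: "norm u = 1" and ae: "AE y in M. moebius_ball x1 y = (moebius_ball x1 y \<bullet> u) *\<^sub>R u \<and>
      (strict_mono_on {0..1} g \<longrightarrow> moebius_ball x1 y = u \<or> moebius_ball x1 y = - u)"
    using moebius_average_two_zeros[OF M(1) g admissible_mono[OF adm g(2)] x ne V] by blast
  show False
    using adm unfolding admissible_def
  proof
    assume "condition_i g"
    \<comment> \<open>The two boundary points that T at \<open>x1\<close> sends to the ends of the
      axis. They carry all the mass, yet each carries less than half of it.\<close>
    define p q where "p = moebius_ball (- x1) u" and "q = moebius_ball (- x1) (- u)"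
    have pq: "p \<in> sphere 0 1" "q \<in> sphere 0 1"
      unfolding p_def q_def using x u by (intro moebius_in_sphere; simp)+
    have s: "{p} \<in> sets M" "{q} \<in> sets M"
      using pq by (auto intro!: in_sets_cball[OF M(1)])
    have "AE y in M. y \<in> {p} \<union> {q}"
      using ae AE_space
    proof eventually_elim
      case (elim y)
      then have "moebius_ball x1 y = u \<or> moebius_ball x1 y = - u"
        using \<open>condition_i g\<close> by (simp add: condition_i_def)
      then show ?case
        using moebius_inverse[OF x(1), of y] elim(2) by (auto simp: p_def q_def sp)
    qed
    then have "measure M (space M) \<le> measure M ({p} \<union> {q})"
      using s by (intro finite_measure_mono_AE sets.Un) auto
    also have "\<dots> \<le> measure M {p} + measure M {q}"
      using s by (intro measure_subadditive) auto
    also have "\<dots> < measure M (cball 0 1)"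
      using M(2)[unfolded point_mass_condition_def, rule_format, OF pq(1)]
        M(2)[unfolded point_mass_condition_def, rule_format, OF pq(2)] by simp
    finally show False by (simp add: sp)
  next
    assume "condition_ii g M"
    obtain \<gamma> where \<gamma>: "hyperbolic_geodesic \<gamma>"
      "\<And>y. y \<in> cball 0 1 \<Longrightarrow> moebius_ball x1 y = (moebius_ball x1 y \<bullet> u) *\<^sub>R u \<Longrightarrow> y \<in> closure \<gamma>"
      using moebius_axis_pullback_in_geodesic[OF x(1) u] by blast
    define N where "N = cball 0 1 - closure \<gamma>"
    have N: "N \<in> sets M" unfolding N_def by (intro in_sets_cball[OF M(1)]) auto
    have "{y \<in> space M. \<not> y \<notin> N} = N" unfolding sp N_def by blast
    moreover have "AE y in M. y \<notin> N"
      using ae AE_space by eventually_elim (use \<gamma>(2) sp in \<open>auto simp: N_def\<close>)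
    ultimately have "emeasure M (cball 0 1 - closure \<gamma>) = 0"
      using AE_iff_measurable[OF N, of "\<lambda>y. y \<notin> N"] unfolding N_def by blast
    then show False
      using \<open>condition_ii g M\<close> \<gamma>(1) by (auto simp: condition_ii_def supported_in_closed_geodesic_def)
  qed
qed

section \<open>Limits of the averaged field\<close>

lemma integral_const_cball:
  fixes M :: "(real^'n) measure"
  assumes "finite_borel_measure_cball M"
  shows "(\<integral>y. c \<partial>M) = measure M (cball 0 1) * (c :: real)"
  by (simp add: finite_borel_measure_cballD(1)[OF assms])

text \<open>The constant 1 is a test function on the closed ball, so no mass is lost in the
  limit.\<close>

lemma weakly_converges_cball_mass:
  fixes M :: "(real^'n) measure"
  assumes "weakly_converges_cball Mk M" "finite_borel_measure_cball M"
    "\<And>k. finite_borel_measure_cball (Mk k)"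
  shows "(\<lambda>k. measure (Mk k) (cball 0 1)) \<longlonglongrightarrow> measure M (cball 0 1)"
proof -
  have "(\<lambda>k. \<integral>y. 1 \<partial>Mk k) \<longlonglongrightarrow> (\<integral>y. (1 :: real) \<partial>M)"
    using continuous_on_const by (rule assms(1)[unfolded weakly_converges_cball_def, rule_format])
  then show ?thesis
    unfolding integral_const_cball[OF assms(2)] integral_const_cball[OF assms(3)] by simp
qed

lemma moebius_average_tendsto_measure:
  fixes M :: "(real^'n) measure"
  assumes Mk: "weakly_converges_cball Mk M" "\<And>k. finite_borel_measure_cball (Mk k)"
    and M: "finite_borel_measure_cball M" and g: "continuous_on {0..1} g" "g 0 = 0"
    and x: "x \<in> ball 0 1"
  shows "(\<lambda>k. moebius_average g (Mk k) x) \<longlonglongrightarrow> moebius_average g M x"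
proof (subst tendsto_componentwise_iff, intro ballI)
  fix e :: "real^'n"
  have "continuous_on (cball 0 1) (\<lambda>y. radial_component g e (moebius_ball x y))"
    unfolding radial_field_inner[symmetric]
    using continuous_on_radial_field_moebius[OF g x] by (intro continuous_intros)
  then show "(\<lambda>k. moebius_average g (Mk k) x \<bullet> e) \<longlonglongrightarrow> moebius_average g M x \<bullet> e"
    using Mk(1) unfolding moebius_average_inner(2)[OF Mk(2) g x] moebius_average_inner(2)[OF M g x]
      weakly_converges_cball_def by blast
qed

text \<open>Uniformity in y allows the error to be integrated against measures that vary with k. It
  comes from uniform continuity on a compact product.\<close>

lemma radial_field_moebius_uniform:
  fixes x :: "real^'n"
  assumes g: "continuous_on {0..1} g" "g 0 = 0" and x: "x \<in> ball 0 1"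
    and X: "X \<longlonglongrightarrow> x" and e: "0 < e"
  shows "\<forall>\<^sub>F k in sequentially. \<forall>y \<in> cball 0 1.
    norm (radial_field g (moebius_ball (X k) y) - radial_field g (moebius_ball x y)) \<le> e"
proof -
  define h where "h = (\<lambda>(x, y). radial_field g (moebius_ball x y :: real^'n))"
  \<comment> \<open>A radius strictly between |x| and 1 leaves room for the X k near x while keeping
    the first factor compact inside the open ball.\<close>
  obtain r where r: "norm x < r" "r < 1" using x dense[of "norm x" 1] by auto
  define K where "K = cball (0 :: real^'n) r \<times> cball (0 :: real^'n) 1"
  have K: "K \<subseteq> ball 0 1 \<times> cball 0 1" using r by (auto simp: K_def)
  have "(\<lambda>(x, y). moebius_ball x y) ` K \<subseteq> cball 0 1"
    using K moebius_in_cball by fast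
  then have "continuous_on K h"
    unfolding h_def case_prod_beta
    by (intro continuous_on_compose2[OF continuous_on_radial_field[OF g]
        continuous_on_subset[OF continuous_on_moebius K, unfolded case_prod_beta]]) (auto simp: case_prod_beta)
  moreover have "compact K" unfolding K_def by (intro compact_Times compact_cball)
  ultimately have "uniformly_continuous_on K h" by (rule compact_uniformly_continuous)
  then obtain d where d: "0 < d"
    "\<And>p q. p \<in> K \<Longrightarrow> q \<in> K \<Longrightarrow> dist q p < d \<Longrightarrow> dist (h q) (h p) < e"
    using e unfolding uniformly_continuous_on_def by metis
  have "\<forall>\<^sub>F k in sequentially. dist (X k) x < min d (r - norm x)"
    using X d(1) r by (intro tendstoD) auto
  then show ?thesis
  proof eventually_elim
    case (elim k)
    show ?case
    proof
      fix y :: "real^'n" assume y: "y \<in> cball 0 1"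
      have "norm (X k) \<le> norm x + dist (X k) x"
        by (metis dist_norm norm_triangle_sub)
      then have "(X k, y) \<in> K" "(x, y) \<in> K" using elim r y by (auto simp: K_def)
      moreover have "dist (X k, y) (x, y) < d" using elim by (simp add: dist_Pair_Pair)
      ultimately have "dist (h (X k, y)) (h (x, y)) < e" using d(2) by blast
      then show "norm (radial_field g (moebius_ball (X k) y) - radial_field g (moebius_ball x y)) \<le> e"
        by (simp add: h_def dist_norm)
    qed
  qed
qed

text \<open>Moving the point costs at most a uniform error times the total mass, which is eventually
  bounded; moving the measure at the fixed point x is weak convergence.\<close>

lemma moebius_average_tendsto:
  fixes M :: "(real^'n) measure"
  assumes Mk: "weakly_converges_cball Mk M" "\<And>k. finite_borel_measure_cball (Mk k)"
    and M: "finite_borel_measure_cball M" and g: "continuous_on {0..1} g" "g 0 = 0"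
    and x: "x \<in> ball 0 1" "\<And>k. X k \<in> ball 0 1" and X: "X \<longlonglongrightarrow> x"
  shows "(\<lambda>k. moebius_average g (Mk k) (X k)) \<longlonglongrightarrow> moebius_average g M x"
proof -
  define m where "m = measure M (cball 0 1)"
  have m: "0 \<le> m" by (simp add: m_def)
  have "(\<lambda>k. moebius_average g (Mk k) (X k) - moebius_average g (Mk k) x) \<longlonglongrightarrow> 0"
  proof (rule tendstoI)
    fix e :: real assume e: "0 < e"
    \<comment> \<open>m + 1 eventually bounds the masses, so the integrated error is at most d (m +
      1) = e / 2.\<close>
    define d where "d = e / 2 / (m + 1)"
    have m1: "0 < m + 1" using m by simp
    then have d: "0 < d" using e by (simp add: d_def)
    have "e / 2 = d * (m + 1)"
      by (rule nonzero_divide_eq_eq[THEN iffD1]) (use m1 in \<open>auto simp: d_def\<close>)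
    then have dm: "d * (m + 1) < e" using e by simp
    have "\<forall>\<^sub>F k in sequentially. measure (Mk k) (cball 0 1) < m + 1"
      using weakly_converges_cball_mass[OF Mk(1) M Mk(2)] by (rule order_tendstoD) (simp add: m_def)
    then show "\<forall>\<^sub>F k in sequentially.
        dist (moebius_average g (Mk k) (X k) - moebius_average g (Mk k) x) 0 < e"
      using radial_field_moebius_uniform[OF g x(1) X d]
    proof eventually_elim
      case (elim k)
      note int = integrable_cball[OF Mk(2) continuous_on_radial_field_moebius[OF g]]
      have "norm (moebius_average g (Mk k) (X k) - moebius_average g (Mk k) x)
          = norm (\<integral>y. radial_field g (moebius_ball (X k) y) - radial_field g (moebius_ball x y) \<partial>Mk k)"
        unfolding moebius_average_def using int x by (subst Bochner_Integration.integral_diff) auto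
      also have "\<dots> \<le> (\<integral>y. norm (radial_field g (moebius_ball (X k) y) - radial_field g (moebius_ball x y)) \<partial>Mk k)"
        by (rule integral_norm_bound)
      also have "\<dots> \<le> (\<integral>y. d \<partial>Mk k)"
        using int x elim(2) finite_borel_measure_cballD(1,2)[OF Mk(2)]
        by (intro integral_mono integrable_norm Bochner_Integration.integrable_diff
            finite_measure.integrable_const) auto
      also have "\<dots> = d * measure (Mk k) (cball 0 1)" 
        unfolding integral_const_cball[OF Mk(2)] by (rule mult.commute)
      also have "\<dots> \<le> d * (m + 1)" using d elim(1) by (intro mult_left_mono) auto
      finally show ?case using dm by simp
    qed
  qed
  from tendsto_add[OF this moebius_average_tendsto_measure[OF Mk M g x(1)]] show ?thesis by simp
qed

section \<open>Behaviour near the boundary sphere\<close>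

text \<open>Once X k is within d / 2 of the limit \<open>\<xi>\<close>, |X k + y| is at least d / 2.
  Then \<open>norm_moebius_minus_le\<close> bounds the distance from T(y) to X k by a quantity
  independent of y that tends to 0.\<close>

lemma moebius_uniform_limit_sphere:
  fixes \<xi> :: "real^'n"
  assumes X: "X \<longlonglongrightarrow> \<xi>" "\<And>k. X k \<in> ball 0 1" and \<xi>: "\<xi> \<in> sphere 0 1"
    and d: "0 < d" and e: "0 < e"
  shows "\<forall>\<^sub>F k in sequentially. \<forall>y \<in> cball 0 1. d \<le> dist y (- \<xi>) \<longrightarrow> dist (moebius_ball (X k) y) \<xi> < e"
proof -
  have "(\<lambda>k. (1 - X k \<bullet> X k) / (d / 2) + dist (X k) \<xi>) \<longlonglongrightarrow> (1 - \<xi> \<bullet> \<xi>) / (d / 2) + dist \<xi> \<xi>"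
    using d by (intro tendsto_intros X) auto
  then have "(\<lambda>k. (1 - X k \<bullet> X k) / (d / 2) + dist (X k) \<xi>) \<longlonglongrightarrow> 0"
    using \<xi>[unfolded in_sphere_iff_inner] by simp
  then have "\<forall>\<^sub>F k in sequentially. (1 - X k \<bullet> X k) / (d / 2) + dist (X k) \<xi> < e"
    using e by (rule order_tendstoD)
  moreover have "\<forall>\<^sub>F k in sequentially. dist (X k) \<xi> < d / 2"
    using X d by (intro tendstoD) auto
  ultimately show ?thesis
  proof eventually_elim
    case (elim k)
    show ?case
    proof (intro ballI impI)
      fix y :: "real^'n" assume y: "y \<in> cball 0 1" "d \<le> dist y (- \<xi>)"
      have "dist y (- \<xi>) \<le> norm (X k + y) + dist (X k) \<xi>"
        using norm_triangle_ineq4[of "X k + y" "X k - \<xi>"] by (simp add: dist_norm add.commute)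
      then have le: "d / 2 \<le> norm (X k + y)" using y(2) elim(2) by simp
      then have n0: "0 < norm (X k + y)" using d by linarith
      then have "X k + y \<noteq> 0" by auto
      then have "norm (moebius_ball (X k) y - X k) \<le> (1 - X k \<bullet> X k) / norm (X k + y)"
        using X(2) y(1) by (intro norm_moebius_minus_le)
      also have "\<dots> \<le> (1 - X k \<bullet> X k) / (d / 2)"
        using X(2)[of k, unfolded in_ball_iff_inner] le d n0
        by (intro divide_left_mono mult_pos_pos) auto
      finally have "dist (moebius_ball (X k) y) (X k) \<le> (1 - X k \<bullet> X k) / (d / 2)"
        by (simp add: dist_norm)
      then show "dist (moebius_ball (X k) y) \<xi> < e"
        using elim(1) dist_triangle[of "moebius_ball (X k) y" \<xi> "X k"] by linarith
    qed
  qed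
qed

lemma radial_component_self:
  assumes "norm u = 1"
  shows "radial_component g u u = g 1"
  by (simp add: radial_component_def assms norm_eq_1[THEN iffD1, OF assms])

lemma abs_radial_component_le:
  assumes "norm u \<le> 1"
  shows "\<bar>radial_component g u z\<bar> \<le> \<bar>g (norm z)\<bar>"
proof -
  have "\<bar>z \<bullet> u\<bar> \<le> norm z * norm u" by (rule Cauchy_Schwarz_ineq2)
  also have "\<dots> \<le> norm z * 1" using assms by (intro mult_left_mono) auto
  finally have "\<bar>(z \<bullet> u) / norm z\<bar> \<le> 1" by (cases "z = 0") auto
  then have "\<bar>g (norm z)\<bar> * \<bar>(z \<bullet> u) / norm z\<bar> \<le> \<bar>g (norm z)\<bar> * 1"
    by (intro mult_left_mono) auto
  then show ?thesis by (simp add: radial_component_def abs_mult)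
qed

text \<open>Weak convergence sees only continuous functions, so the bad set around
  \<open>- \<xi>\<close> is measured by a continuous cutoff. The resulting lower bound for the
  component along \<open>\<xi>\<close> has a positive integral in the limit.\<close>

lemma moebius_average_no_zeros_near_sphere:
  fixes M :: "(real^'n) measure"
  assumes Mk: "weakly_converges_cball Mk M" "\<And>k. finite_borel_measure_cball (Mk k)"
    and M: "finite_borel_measure_cball M" "point_mass_condition M"
    and g: "continuous_on {0..1} g" "g 0 = 0" and mono: "mono_on {0..1} g" and pos: "0 < g 1"
    and X: "X \<longlonglongrightarrow> \<xi>" "\<And>k. X k \<in> ball 0 1" and \<xi>: "\<xi> \<in> sphere 0 1"
  shows "\<exists>k. moebius_average g (Mk k) (X k) \<noteq> 0"
proof (rule ccontr)
  assume "\<not> (\<exists>k. moebius_average g (Mk k) (X k) \<noteq> 0)"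
  then have V: "moebius_average g (Mk k) (X k) = 0" for k by simp
  interpret finite_measure M using finite_borel_measure_cballD(2)[OF M(1)] .
  have sp: "space M = cball 0 1" using finite_borel_measure_cballD(1)[OF M(1)] .
  have n\<xi>: "norm \<xi> = 1" using \<xi> by simp
  define m K where "m = measure M (cball 0 1)" and "K = g 1"
  have m: "0 < m" using finite_borel_measure_cballD(3)[OF M(1)] by (simp add: m_def)
  \<comment> \<open>Closed neighbourhoods shrinking to \<open>- \<xi>\<close>; by continuity from
    above and the point mass condition, one of them has less than half the mass.\<close>
  define A where "A = (\<lambda>n. cball (- \<xi>) (inverse (real (Suc n))) \<inter> cball 0 1)"
  have A: "A n \<in> sets M" for n unfolding A_def by (intro in_sets_cball[OF M(1)]) auto
  have "decseq A"
    unfolding decseq_def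
  proof (intro allI impI)
    fix i j :: nat assume "i \<le> j"
    then have "inverse (real (Suc j)) \<le> inverse (real (Suc i))" by (intro le_imp_inverse_le) auto
    then show "A j \<subseteq> A i" unfolding A_def by (intro Int_mono subset_cball) auto
  qed
  then have "(\<lambda>n. measure M (A n)) \<longlonglongrightarrow> measure M (\<Inter>n. A n)"
    using A by (intro finite_Lim_measure_decseq) auto
  also have "(\<Inter>n. A n) = {- \<xi>}"
  proof (intro equalityI subsetI)
    fix y assume y: "y \<in> (\<Inter>n. A n)"
    have "dist (- \<xi>) y \<le> 0"
    proof (rule LIMSEQ_le_const[OF LIMSEQ_inverse_real_of_nat])
      show "\<exists>N. \<forall>n\<ge>N. dist (- \<xi>) y \<le> inverse (real (Suc n))"
        using y by (auto simp: A_def)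
    qed
    then show "y \<in> {- \<xi>}" by simp
  qed (auto simp: A_def n\<xi>)
  finally have "(\<lambda>n. measure M (A n)) \<longlonglongrightarrow> measure M {- \<xi>}" .
  moreover have "measure M {- \<xi>} < m / 2"
    using M(2) n\<xi> by (simp add: point_mass_condition_def m_def)
  ultimately have "\<forall>\<^sub>F n in sequentially. measure M (A n) < m / 2"
    by (rule order_tendstoD)
  then obtain n where n: "measure M (A n) < m / 2"
    by (auto simp: eventually_sequentially)
  define d where "d = inverse (real (Suc n))"
  have d: "0 < d" by (simp add: d_def)
  \<comment> \<open>A piecewise linear cutoff: 1 within d / 2 of \<open>- \<xi>\<close>, 0 beyond d,
    and hence at most the indicator of \<open>A n\<close>.\<close>
  define \<psi> :: "real^'n \<Rightarrow> real" where "\<psi> = (\<lambda>y. max 0 (min 1 (2 - 2 * dist y (- \<xi>) / d)))"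
  have \<psi>: "continuous_on S \<psi>" for S unfolding \<psi>_def by (intro continuous_intros) (use d in auto)
  have \<psi>1: "\<psi> y = 1" if "dist y (- \<xi>) < d / 2" for y
    using that d by (simp add: \<psi>_def field_simps)
  have \<psi>0: "0 \<le> \<psi> y" for y by (simp add: \<psi>_def)
  have \<psi>A: "\<psi> y \<le> indicator (A n) y" if "y \<in> cball 0 1" for y
  proof (cases "y \<in> A n")
    case True
    then show ?thesis by (simp add: \<psi>_def)
  next
    case False
    then have "d < dist y (- \<xi>)"
      using that unfolding A_def d_def[symmetric] by (simp add: dist_commute)
    then have "2 \<le> 2 * dist y (- \<xi>) / d" using d by (simp add: pos_le_divide_eq)
    then show ?thesis by (simp add: \<psi>_def)
  qed
  have "(\<integral>y. \<psi> y \<partial>M) \<le> (\<integral>y. indicator (A n) y \<partial>M)"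
  proof (intro integral_mono)
    show "integrable M (indicator (A n) :: _ \<Rightarrow> real)"
      using A by (intro integrable_real_indicator) (simp_all add: less_top[symmetric])
  qed (use \<psi>A sp integrable_cball[OF M(1) \<psi>] in auto)
  also have "\<dots> = measure M (A n)" using sets.sets_into_space[OF A] by (simp add: Int_absorb2)
  finally have a: "(\<integral>y. \<psi> y \<partial>M) < m / 2" using n by simp
  \<comment> \<open>Chosen so that e m is half of K (m - 2 I), where I is the integral of the
    cutoff; then (K - e) m - 2 K I stays positive.\<close>
  define e where "e = K * (m - 2 * (\<integral>y. \<psi> y \<partial>M)) / (2 * m)"
  have e: "0 < e" using a m pos by (simp add: e_def K_def)
  have em: "e * m < K * (m - 2 * (\<integral>y. \<psi> y \<partial>M))"
    using a m pos by (simp add: e_def K_def)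
  have "continuous_on (cball 0 1) (\<lambda>z. radial_component g \<xi> z)"
    unfolding radial_field_inner[symmetric]
    using continuous_on_radial_field[OF g] by (intro continuous_intros)
  then obtain \<eta> where \<eta>: "0 < \<eta>" "\<And>z. z \<in> cball 0 1 \<Longrightarrow> dist z \<xi> < \<eta> \<Longrightarrow>
      dist (radial_component g \<xi> z) (radial_component g \<xi> \<xi>) < e"
    using \<xi> e unfolding continuous_on_iff by (metis sphere_cball subsetD)
  have "\<forall>\<^sub>F k in sequentially. (K - e) * measure (Mk k) (cball 0 1) - 2 * K * (\<integral>y. \<psi> y \<partial>Mk k) \<le> 0"
    using moebius_uniform_limit_sphere[OF X \<xi> half_gt_zero[OF d] \<eta>(1)]
  proof eventually_elim
    case (elim k)
    \<comment> \<open>Near \<open>- \<xi>\<close> the cutoff is 1 and monotonicity of g gives the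
      lower bound -K; elsewhere T(y) is close to \<open>\<xi>\<close>, where the component is
      K.\<close>
    have le: "(K - e) - 2 * K * \<psi> y \<le> radial_component g \<xi> (moebius_ball (X k) y)"
      if y: "y \<in> cball 0 1" for y
    proof -
      have T: "moebius_ball (X k) y \<in> cball 0 1" using moebius_in_cball[OF X(2) y] .
      show ?thesis
      proof (cases "dist y (- \<xi>) < d / 2")
        case True
        have "0 \<le> g (norm (moebius_ball (X k) y))"
          using mono_onD[OF mono, of 0 "norm (moebius_ball (X k) y)"] T g(2) by simp
        moreover have "g (norm (moebius_ball (X k) y)) \<le> K"
          unfolding K_def using T by (intro mono_onD[OF mono]) auto
        ultimately have "- K \<le> radial_component g \<xi> (moebius_ball (X k) y)"
          using abs_radial_component_le[of \<xi> g "moebius_ball (X k) y"] n\<xi> by simp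
        then show ?thesis using \<psi>1[OF True] e by simp
      next
        case False
        then have "dist (moebius_ball (X k) y) \<xi> < \<eta>" using elim y by simp
        then have "K - e \<le> radial_component g \<xi> (moebius_ball (X k) y)"
          using \<eta>(2)[OF T] by (simp add: radial_component_self[OF n\<xi>] K_def dist_real_def)
        moreover have "0 \<le> K * \<psi> y" using \<psi>0[of y] pos by (simp add: K_def)
        ultimately show ?thesis by simp
      qed
    qed
    interpret k: finite_measure "Mk k" using finite_borel_measure_cballD(2)[OF Mk(2)] .
    have i: "integrable (Mk k) \<psi>" using integrable_cball[OF Mk(2) \<psi>] .
    have "(K - e) * measure (Mk k) (cball 0 1) - 2 * K * (\<integral>y. \<psi> y \<partial>Mk k)
        = (\<integral>y. (K - e) - 2 * K * \<psi> y \<partial>Mk k)"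
      using i by (simp add: Bochner_Integration.integral_diff finite_borel_measure_cballD(1)[OF Mk(2)])
    also have "\<dots> \<le> (\<integral>y. radial_component g \<xi> (moebius_ball (X k) y) \<partial>Mk k)"
      using le i moebius_average_inner(1)[OF Mk(2) g X(2)]
      by (intro integral_mono) (auto simp: finite_borel_measure_cballD(1)[OF Mk(2)])
    also have "\<dots> = 0"
      using moebius_average_inner(2)[OF Mk(2)[of k] g X(2)[of k], of \<xi>] V by simp
    finally show ?case .
  qed
  moreover have "(\<lambda>k. (K - e) * measure (Mk k) (cball 0 1) - 2 * K * (\<integral>y. \<psi> y \<partial>Mk k))
      \<longlonglongrightarrow> (K - e) * m - 2 * K * (\<integral>y. \<psi> y \<partial>M)"
    unfolding m_def using weakly_converges_cball_mass[OF Mk(1) M(1) Mk(2)] Mk(1) \<psi>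
    by (intro tendsto_intros) (auto simp: weakly_converges_cball_def)
  ultimately have "(K - e) * m - 2 * K * (\<integral>y. \<psi> y \<partial>M) \<le> 0"
    by (intro tendsto_upperbound) auto
  then show False using em by (simp add: algebra_simps)
qed

text \<open>With g merely continuous, |g| may exceed g 1 inside the ball, so dominated convergence
  for a fixed measure replaces the cutoff estimate. The direction is X k itself, as Brouwer's
  theorem will require.\<close>

lemma moebius_average_outward_near_sphere:
  fixes M :: "(real^'n) measure"
  assumes M: "finite_borel_measure_cball M" "point_mass_condition M"
    and g: "continuous_on {0..1} g" "g 0 = 0" and pos: "0 < g 1"
    and X: "X \<longlonglongrightarrow> \<xi>" "\<And>k. X k \<in> ball 0 1" and \<xi>: "\<xi> \<in> sphere 0 1"
  shows "\<exists>k. 0 < moebius_average g M (X k) \<bullet> X k"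
proof (rule ccontr)
  assume "\<not> (\<exists>k. 0 < moebius_average g M (X k) \<bullet> X k)"
  then have V: "moebius_average g M (X k) \<bullet> X k \<le> 0" for k by (simp add: not_less)
  interpret finite_measure M using finite_borel_measure_cballD(2)[OF M(1)] .
  have sp: "space M = cball 0 1" using finite_borel_measure_cballD(1)[OF M(1)] .
  have n\<xi>: "norm \<xi> = 1" using \<xi> by simp
  have s\<xi>: "{- \<xi>} \<in> sets M" using \<xi> by (intro in_sets_cball[OF M(1)]) auto
  define C where "C = (\<lambda>k y. radial_component g (X k) (moebius_ball (X k) y))"
  \<comment> \<open>T(y) may fail to converge at y = \<open>- \<xi>\<close>. It stays on the sphere
    there, so -g 1 is a lower bound for the component; inserting it makes \<open>F\<close> converge
    pointwise to \<open>G\<close> from below the integrand \<open>C\<close>.\<close>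
  define F where "F = (\<lambda>k y. if y \<in> {- \<xi>} then - g 1 else C k y)"
  define G :: "real^'n \<Rightarrow> real" where "G = (\<lambda>y. g 1 - 2 * g 1 * indicator {- \<xi>} y)"
  have "bounded (g ` {0..1})"
    by (rule compact_imp_bounded[OF compact_continuous_image[OF g(1) compact_Icc]])
  then obtain B where B: "\<forall>r \<in> {0..1}. \<bar>g r\<bar> \<le> B"
    unfolding bounded_iff by auto
  have nX: "norm (X k) \<le> 1" for k using X(2)[of k] by simp
  have CB: "\<bar>C k y\<bar> \<le> \<bar>g (norm (moebius_ball (X k) y))\<bar>" for k y
    unfolding C_def using abs_radial_component_le[OF nX] .
  have iC: "integrable M (C k)" for k
    unfolding C_def using moebius_average_inner(1)[OF M(1) g X(2)] .
  have C: "C k \<in> borel_measurable M" for k using iC by (rule borel_measurable_integrable)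
  have F: "F k \<in> borel_measurable M" for k
    unfolding F_def using C s\<xi> by (intro measurable_If_set) auto
  have FC: "F k y \<le> C k y" if y: "y \<in> cball 0 1" for k y
  proof (cases "y = - \<xi>")
    case True
    have "moebius_ball (X k) y \<in> sphere 0 1"
      using True n\<xi> by (intro moebius_in_sphere X) simp
    then show ?thesis using CB[of k y] pos True by (simp add: F_def)
  qed (simp add: F_def)
  have FB: "norm (F k y) \<le> B" if y: "y \<in> cball 0 1" for k y
  proof (cases "y = - \<xi>")
    case True
    then show ?thesis using bspec[OF B, of 1] pos by (simp add: F_def)
  next
    case False
    have "moebius_ball (X k) y \<in> cball 0 1" using X(2) y by (rule moebius_in_cball)
    then have "\<bar>g (norm (moebius_ball (X k) y))\<bar> \<le> B" using B by simp
    then show ?thesis using CB[of k y] False by (simp add: F_def)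
  qed
  have lim: "(\<lambda>k. F k y) \<longlonglongrightarrow> G y" if y: "y \<in> cball 0 1" for y
  proof (cases "y = - \<xi>")
    case True
    then show ?thesis by (simp add: F_def G_def)
  next
    case False
    have "(\<lambda>k. moebius_ball (X k) y) \<longlonglongrightarrow> \<xi>"
    proof (rule tendstoI)
      fix e :: real assume e: "0 < e"
      have "0 < dist y (- \<xi>)" using False by simp
      from moebius_uniform_limit_sphere[OF X \<xi> this e]
      show "\<forall>\<^sub>F k in sequentially. dist (moebius_ball (X k) y) \<xi> < e"
        by eventually_elim (use y in auto)
    qed
    then have "(\<lambda>k. radial_field g (moebius_ball (X k) y)) \<longlonglongrightarrow> radial_field g \<xi>"
      using moebius_in_cball[OF X(2) y] n\<xi>
      by (intro continuous_on_tendsto_compose[OF continuous_on_radial_field[OF g]]) auto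
    then have "(\<lambda>k. radial_field g (moebius_ball (X k) y) \<bullet> X k) \<longlonglongrightarrow> radial_field g \<xi> \<bullet> \<xi>"
      by (intro tendsto_inner X)
    then show ?thesis
      using False by (simp add: F_def G_def C_def radial_field_inner radial_component_self[OF n\<xi>])
  qed
  have "(\<lambda>k. \<integral>y. F k y \<partial>M) \<longlonglongrightarrow> (\<integral>y. G y \<partial>M)"
    using F FB lim s\<xi> sp
    by (intro integral_dominated_convergence[where w = "\<lambda>_. B"]) (auto simp: G_def)
  moreover have "(\<integral>y. F k y \<partial>M) \<le> 0" for k
  proof -
    have "(\<integral>y. F k y \<partial>M) \<le> (\<integral>y. C k y \<partial>M)"
    proof (intro integral_mono iC)
      show "integrable M (F k)"
        using F FB sp by (intro integrable_const_bound[where B = B]) auto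
    qed (use FC sp in auto)
    also have "\<dots> \<le> 0"
      using V[of k] moebius_average_inner(2)[OF M(1) g X(2)[of k], of "X k"] by (simp add: C_def)
    finally show ?thesis .
  qed
  ultimately have "(\<integral>y. G y \<partial>M) \<le> 0"
    by (intro tendsto_upperbound) (auto intro: always_eventually)
  moreover have "(\<integral>y. G y \<partial>M) = g 1 * (measure M (cball 0 1) - 2 * measure M {- \<xi>})"
  proof -
    have i: "integrable M (indicator {- \<xi>} :: _ \<Rightarrow> real)"
      using s\<xi> by (intro integrable_real_indicator) (simp_all add: less_top[symmetric])
    have "(\<integral>y. G y \<partial>M) = (\<integral>y. g 1 \<partial>M) - (\<integral>y. 2 * g 1 * indicator {- \<xi>} y \<partial>M)"
      unfolding G_def using i by (intro Bochner_Integration.integral_diff) auto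
    also have "{- \<xi>} \<inter> space M = {- \<xi>}" using n\<xi> by (simp add: sp)
    then have "(\<integral>y. 2 * g 1 * indicator {- \<xi>} y \<partial>M) = 2 * g 1 * measure M {- \<xi>}" by simp
    finally show ?thesis unfolding integral_const_cball[OF M(1)] by (simp add: algebra_simps)
  qed
  moreover have "0 < measure M (cball 0 1) - 2 * measure M {- \<xi>}"
    using M(2)[unfolded point_mass_condition_def, rule_format, of "- \<xi>"] n\<xi> by simp
  ultimately show False using pos by (simp add: mult_le_0_iff)
qed

section \<open>Continuity of the averaged field and existence of a zero\<close>

lemma continuous_on_moebius_average:
  fixes M :: "(real^'n) measure"
  assumes M: "finite_borel_measure_cball M" and g: "continuous_on {0..1} g" "g 0 = 0"
  shows "continuous_on (ball 0 1) (moebius_average g M)"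
  unfolding continuous_on_sequentially
proof (intro allI impI ballI, elim conjE)
  fix X x assume x: "x \<in> ball 0 1" and X: "\<forall>n. X n \<in> ball (0::real^'n) 1" "X \<longlonglongrightarrow> x"
  have "weakly_converges_cball (\<lambda>_. M) M" by (simp add: weakly_converges_cball_def)
  then have "(\<lambda>k. moebius_average g M (X k)) \<longlonglongrightarrow> moebius_average g M x"
    using M M g x X by (intro moebius_average_tendsto[of "\<lambda>_. M"]) auto
  then show "(moebius_average g M \<circ> X) \<longlonglongrightarrow> moebius_average g M x" by (simp add: o_def)
qed

text \<open>Brouwer's theorem is applied to x - V x followed by the radial retraction onto the ball.
  A fixed point where the retraction is active lies on the sphere, and there V x would point
  inward.\<close>

lemma brouwer_outward_zero:
  fixes V :: "'a::euclidean_space \<Rightarrow> 'a"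
  assumes r: "0 < r" and V: "continuous_on (cball 0 r) V"
    and out: "\<And>x. norm x = r \<Longrightarrow> 0 < V x \<bullet> x"
  obtains x where "norm x \<le> r" "V x = 0"
proof -
  \<comment> \<open>\<open>c\<close> is the factor of the radial retraction: 1 inside the ball, and
    otherwise what brings the norm down to r.\<close>
  define c f where "c = (\<lambda>x. r / max r (norm (x - V x)))" and "f = (\<lambda>x. c x *\<^sub>R (x - V x))"
  have c: "0 < c x" "c x \<le> 1" for x using r by (simp_all add: c_def)
  have nf: "norm (f x) = min r (norm (x - V x))" for x
    using r by (simp add: f_def c_def max_def min_def)
  have "continuous_on (cball 0 r) f"
    unfolding f_def c_def using r by (intro continuous_intros V) auto
  moreover have "f \<in> cball 0 r \<rightarrow> cball 0 r" using nf by auto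
  ultimately obtain x where x: "x \<in> cball 0 r" "f x = x"
    using brouwer[of "cball 0 r" f] r by auto
  have "V x = 0"
  proof (cases "norm (x - V x) \<le> r")
    case True
    then have "f x = x - V x" using r by (simp add: f_def c_def max_absorb1)
    then show ?thesis using x by simp
  next
    case False
    then have "norm x = r" using nf[of x] x by simp
    have c1: "c x < 1" using False r by (simp add: c_def divide_less_eq_1)
    \<comment> \<open>The fixed point equation makes V x a nonpositive multiple of x, against the
      outward condition.\<close>
    have "x - c x *\<^sub>R x = - (c x *\<^sub>R V x)" using x(2) by (simp add: f_def algebra_simps)
    then have "(x - c x *\<^sub>R x) \<bullet> x = - (c x *\<^sub>R V x) \<bullet> x" by simp
    then have "(1 - c x) * (x \<bullet> x) = - (c x * (V x \<bullet> x))" by (simp add: algebra_simps)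
    moreover have "0 < c x * (V x \<bullet> x)" using c out[OF \<open>norm x = r\<close>] by simp
    moreover have "0 \<le> (1 - c x) * (x \<bullet> x)" using c1 by simp
    ultimately show ?thesis by linarith
  qed
  then show ?thesis using x that by auto
qed

text \<open>If spheres of radii tending to 1 each contained a point where V is not outward, a
  subsequence of these points would converge to the unit sphere and contradict
  \<open>moebius_average_outward_near_sphere\<close>.\<close>

lemma moebius_average_zero_exists:
  fixes M :: "(real^'n) measure"
  assumes M: "finite_borel_measure_cball M" "point_mass_condition M"
    and g: "continuous_on {0..1} g" "g 0 = 0" and pos: "0 < g 1"
  shows "\<exists>x \<in> ball 0 1. moebius_average g M x = 0"
proof -
  have "\<exists>r. 0 < r \<and> r < 1 \<and> (\<forall>x. norm x = r \<longrightarrow> 0 < moebius_average g M x \<bullet> x)"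
  proof (rule ccontr)
    assume no: "\<not> (\<exists>r. 0 < r \<and> r < 1 \<and> (\<forall>x. norm x = r \<longrightarrow> 0 < moebius_average g M x \<bullet> x))"
    \<comment> \<open>The double successor makes the first radius 1/2, so all radii are
      positive.\<close>
    define \<rho> where "\<rho> = (\<lambda>n. 1 - inverse (real (Suc (Suc n))))"
    have \<rho>: "0 < \<rho> n" "\<rho> n < 1" for n by (simp_all add: \<rho>_def field_simps)
    have "\<not> (\<forall>x. norm x = \<rho> n \<longrightarrow> 0 < moebius_average g M x \<bullet> x)" for n
      using no \<rho>[of n] by blast
    then have "\<exists>x. norm x = \<rho> n \<and> moebius_average g M x \<bullet> x \<le> 0" for n
      by (auto simp: not_less)
    then obtain X where X: "\<And>n. norm (X n) = \<rho> n" "\<And>n. moebius_average g M (X n) \<bullet> X n \<le> 0"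
      by metis
    have "\<forall>n. X n \<in> cball 0 1" using X(1) \<rho>(2) by (simp add: less_imp_le)
    then obtain \<xi> r where r: "strict_mono r" "(X \<circ> r) \<longlonglongrightarrow> \<xi>"
      using compact_cball[of "0::real^'n" 1] unfolding compact_def by metis
    have "\<rho> \<longlonglongrightarrow> 1 - 0"
      unfolding \<rho>_def by (intro tendsto_intros LIMSEQ_Suc[OF LIMSEQ_inverse_real_of_nat])
    then have "(\<rho> \<circ> r) \<longlonglongrightarrow> 1" using r(1) by (intro LIMSEQ_subseq_LIMSEQ) auto
    moreover have "(\<lambda>n. norm ((X \<circ> r) n)) \<longlonglongrightarrow> norm \<xi>" using r(2) by (rule tendsto_norm)
    ultimately have "norm \<xi> = 1"
      using X(1) by (intro LIMSEQ_unique) (simp_all add: o_def)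
    then have "\<exists>k. 0 < moebius_average g M ((X \<circ> r) k) \<bullet> (X \<circ> r) k"
      using X(1) \<rho>(2) by (intro moebius_average_outward_near_sphere[OF M g pos r(2)]) auto
    then show False using X(2) by (auto simp: not_less[symmetric])
  qed
  then obtain r where r: "0 < r" "r < 1" "\<And>x. norm x = r \<Longrightarrow> 0 < moebius_average g M x \<bullet> x"
    by blast
  have "continuous_on (cball 0 r) (moebius_average g M)"
    using r by (intro continuous_on_subset[OF continuous_on_moebius_average[OF M(1) g]]) auto
  from brouwer_outward_zero[OF r(1) this r(3)] show ?thesis
    using r(2) by (metis mem_ball_0 order_le_less_trans)
qed

section \<open>The conformal centre and its continuous dependence on the measure\<close>

lemma conformal_centre:
  fixes M :: "(real^'n) measure"
  assumes M: "finite_borel_measure_cball M" "point_mass_condition M"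
    and g: "continuous_on {0..1} g" "g 0 = 0" and adm: "admissible g M"
  shows "\<exists>!x. x \<in> ball 0 1 \<and> moebius_average g M x = 0"
    and "conformal_centre g M \<in> ball 0 1" "moebius_average g M (conformal_centre g M) = 0"
proof -
  have "0 < g 1" using admissible_mono(2)[OF adm g(2), of 1] by simp
  then show *: "\<exists>!x. x \<in> ball 0 1 \<and> moebius_average g M x = 0"
    using moebius_average_zero_exists[OF M g] moebius_average_zero_unique[OF M g adm] by blast
  show "conformal_centre g M \<in> ball 0 1" "moebius_average g M (conformal_centre g M) = 0"
    using theI'[OF *] unfolding conformal_centre_def by blast+
qed

lemma weakly_converges_cball_subseq:
  assumes "weakly_converges_cball Mk M" "strict_mono r"
  shows "weakly_converges_cball (Mk \<circ> r) M"
  unfolding weakly_converges_cball_def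
proof (intro allI impI)
  fix \<psi> :: "real^'a \<Rightarrow> real" assume "continuous_on (cball 0 1) \<psi>"
  then have "(\<lambda>k. \<integral>y. \<psi> y \<partial>Mk k) \<longlonglongrightarrow> (\<integral>y. \<psi> y \<partial>M)"
    using assms(1) by (simp add: weakly_converges_cball_def)
  from LIMSEQ_subseq_LIMSEQ[OF this assms(2)]
  show "(\<lambda>k. \<integral>y. \<psi> y \<partial>(Mk \<circ> r) k) \<longlonglongrightarrow> (\<integral>y. \<psi> y \<partial>M)" by (simp add: o_def)
qed

text \<open>A compactness argument: otherwise some subsequence stays at distance at least e from the
  centre of M, yet has a further subsequence converging in the closed ball.\<close>

lemma conformal_centre_tendsto:
  fixes M :: "(real^'n) measure"
  assumes M: "finite_borel_measure_cball M" "point_mass_condition M" "admissible g M"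
    and Mk: "\<And>k. finite_borel_measure_cball (Mk k)" "\<And>k. point_mass_condition (Mk k)"
      "\<And>k. admissible g (Mk k)"
    and conv: "weakly_converges_cball Mk M"
    and g: "continuous_on {0..1} g" "g 0 = 0"
  shows "(\<lambda>k. conformal_centre g (Mk k)) \<longlonglongrightarrow> conformal_centre g M"
proof (rule ccontr)
  define X where "X = (\<lambda>k. conformal_centre g (Mk k))"
  assume "\<not> (\<lambda>k. conformal_centre g (Mk k)) \<longlonglongrightarrow> conformal_centre g M"
  then obtain e where e: "0 < e" "\<exists>\<^sub>F k in sequentially. e \<le> dist (X k) (conformal_centre g M)"
    unfolding tendsto_iff X_def by (auto simp: not_eventually not_less)
  have "infinite {k. e \<le> dist (X k) (conformal_centre g M)}"
    using e(2) unfolding cofinite_eq_sequentially[symmetric] frequently_cofinite .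
  from infinite_enumerate[OF this]
  obtain r :: "nat \<Rightarrow> nat" where r: "strict_mono r"
    "\<forall>k. e \<le> dist (X (r k)) (conformal_centre g M)"
    by auto
  have X: "X k \<in> ball 0 1" "moebius_average g (Mk k) (X k) = 0" for k
    unfolding X_def using conformal_centre(2,3)[OF Mk(1)[of k] Mk(2)[of k] g Mk(3)[of k]] .
  have "\<forall>n. (X \<circ> r) n \<in> cball 0 1" using X(1) by (simp add: less_imp_le)
  then obtain \<xi> q where q: "\<xi> \<in> cball 0 1" "strict_mono q" "(X \<circ> r \<circ> q) \<longlonglongrightarrow> \<xi>"
    using compact_cball[of "0::real^'n" 1] unfolding compact_def by metis
  define s where "s = r \<circ> q"
  have conv': "weakly_converges_cball (Mk \<circ> s) M"
    using conv r q by (intro weakly_converges_cball_subseq) (simp_all add: s_def strict_mono_o)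
  have Xs: "(X \<circ> s) \<longlonglongrightarrow> \<xi>" using q(3) by (simp add: s_def o_assoc)
  show False
  proof (cases "\<xi> \<in> ball 0 1")
    case True
    have "(\<lambda>k. moebius_average g ((Mk \<circ> s) k) ((X \<circ> s) k)) \<longlonglongrightarrow> moebius_average g M \<xi>"
      using Mk(1) X(1) by (intro moebius_average_tendsto[OF conv' _ M(1) g True _ Xs]) auto
    \<comment> \<open>The sequence of averages is constantly 0, so the limit point is itself a zero
      and uniqueness for M identifies it.\<close>
    then have "moebius_average g M \<xi> = 0" using X(2) by (simp add: LIMSEQ_const_iff)
    then have "\<xi> = conformal_centre g M"
      using moebius_average_zero_unique[OF M(1,2) g M(3)] True conformal_centre[OF M(1,2) g M(3)] by blast
    with Xs have "(X \<circ> s) \<longlonglongrightarrow> conformal_centre g M" by simp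
    from tendstoD[OF this e(1)] obtain k where "dist ((X \<circ> s) k) (conformal_centre g M) < e"
      by (auto simp: eventually_sequentially)
    then show False using r(2)[rule_format, of "q k"] by (simp add: s_def)
  next
    case False
    then have "\<xi> \<in> sphere 0 1" using q(1) by simp
    then have "\<exists>k. moebius_average g ((Mk \<circ> s) k) ((X \<circ> s) k) \<noteq> 0"
      using Mk(1) X(1) admissible_mono[OF M(3) g(2)]
      by (intro moebius_average_no_zeros_near_sphere[OF conv' _ M(1,2) g _ _ Xs]) auto
    then show False using X(2) by auto
  qed
qed

theorem theorem4:
  fixes g :: "real \<Rightarrow> real" and M :: "(real^'n) measure"
  assumes "continuous_on {0..1} g" and "g 0 = 0"
    and "finite_borel_measure_cball M" and "point_mass_condition M"
  shows "(g 1 > 0 \<longrightarrow> (\<exists>x \<in> ball 0 1. moebius_average g M x = 0)) \<and>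
    (condition_i g \<or> condition_ii g M \<longrightarrow>
       (\<exists>!x. x \<in> ball 0 1 \<and> moebius_average g M x = 0)) \<and>
    (\<forall>Mk :: nat \<Rightarrow> (real^'n) measure.
       (\<forall>k. finite_borel_measure_cball (Mk k) \<and> point_mass_condition (Mk k)) \<and>
       weakly_converges_cball Mk M \<and>
       (condition_i g \<or> condition_ii g M \<and> (\<forall>k. condition_ii g (Mk k))) \<longrightarrow>
       (\<lambda>k. conformal_centre g (Mk k)) \<longlonglongrightarrow> conformal_centre g M)"
proof (intro conjI impI allI)
  assume "g 1 > 0"
  then show "\<exists>x \<in> ball 0 1. moebius_average g M x = 0"
    using moebius_average_zero_exists assms by blast
next
  assume "condition_i g \<or> condition_ii g M"
  then show "\<exists>!x. x \<in> ball 0 1 \<and> moebius_average g M x = 0"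
    using conformal_centre(1)[OF assms(3,4,1,2)] by (simp add: admissible_def)
next
  fix Mk :: "nat \<Rightarrow> (real^'n) measure"
  assume Mk: "(\<forall>k. finite_borel_measure_cball (Mk k) \<and> point_mass_condition (Mk k)) \<and>
       weakly_converges_cball Mk M \<and>
       (condition_i g \<or> condition_ii g M \<and> (\<forall>k. condition_ii g (Mk k)))"
  then show "(\<lambda>k. conformal_centre g (Mk k)) \<longlonglongrightarrow> conformal_centre g M"
    using assms by (intro conformal_centre_tendsto) (auto simp: admissible_def)
qed

end
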